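(* Let $G$ be a connected graph whose blocks are complete multipartite graphs. (i) If $k\ge5$ is odd, then $G$ is an exact $k$-leaf power if and only if $G$ is bipartite, equivalently if and only if every block of $G$ is complete bipartite. (ii) If $k\ge8$ is even, then $G$ is an exact $k$-leaf power.
   Context: Graphs are finite, simple, undirected and nonempty. A graph $G$ is an exact $k$-leaf power if there is a tree $T$ whose leaf set is $V(G)$ such that for distinct $u,v\in V(G)$, $uv\in E(G)$ if and only if $\operatorname{dist}_T(u,v)=k$; the vertex of a one-vertex tree counts as a leaf. A block of $G$ is a maximal connected subgraph without a cutvertex of its own. $K_2=K_{1,1}$ counts as complete bipartite; the trivial block $K_1$ (occurring only if $G=K_1$) is also regarded as complete bipartite, with one empty side. *)

theory Defs
  imports "Graph_Theory.Graph_Theory" "HOL-Library.Disjoint_Sets"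
begin

text \<open>
  A finite simple undirected graph is a finite symmetric digraph without loops and parallel arcs
  (\<^locale>\<open>graph\<close>).  The library predicate \<open>Digraph_Component.connected\<close> includes nonemptiness.
  The predicates below are meant for such graphs.
\<close>

text \<open>
  \<open>Digraph_Component.tree\<close> cannot be used: in a symmetric digraph, traversing an edge back and forth
  is a cycle of length 2.  The cycles of the undirected graph are those of length at least 3.
\<close>
definition undirected_tree :: "('a, 'b) pre_digraph \<Rightarrow> bool" where
  "undirected_tree T \<longleftrightarrow>
     Digraph.graph T \<and> Digraph_Component.connected T \<and>
     \<not> (\<exists>p. pre_digraph.cycle T p \<and> 3 \<le> length p)"

definition leaves :: "('a, 'b) pre_digraph \<Rightarrow> 'a set" where
  "leaves T = {v \<in> verts T. out_degree T v = 1 \<or> verts T = {v}}"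

definition graph_dist :: "('a, 'b) pre_digraph \<Rightarrow> 'a \<Rightarrow> 'a \<Rightarrow> ereal" where
  "graph_dist G u v = wf_digraph.\<mu> G (\<lambda>_. 1) u v"

text \<open>
  The type \<^typ>\<open>'a + nat\<close> of tree vertices makes room for arbitrarily many inner vertices besides
  the leaves, which are the vertices of \<open>G\<close>, tagged with \<^const>\<open>Inl\<close>.  As trees are finite, every
  tree with leaf set \<^term>\<open>verts G\<close> has an isomorphic copy of this form.
\<close>
definition exact_leaf_power :: "nat \<Rightarrow> ('a, 'b) pre_digraph \<Rightarrow> bool" where
  "exact_leaf_power k G \<longleftrightarrow>
     (\<exists>T :: ('a + nat) pair_pre_digraph.
        undirected_tree (with_proj T) \<and> leaves (with_proj T) = Inl ` verts G \<and>
        (\<forall>u\<in>verts G. \<forall>v\<in>verts G. u \<noteq> v \<longrightarrow>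
           (u \<rightarrow>\<^bsub>G\<^esub> v \<longleftrightarrow> graph_dist (with_proj T) (Inl u) (Inl v) = ereal (real k))))"

definition cutvertex :: "('a, 'b) pre_digraph \<Rightarrow> 'a \<Rightarrow> bool" where
  "cutvertex G v \<longleftrightarrow> v \<in> verts G \<and>
     (\<exists>x\<in>verts G - {v}. \<exists>y\<in>verts G - {v}.
        x \<rightarrow>\<^sup>*\<^bsub>G\<^esub> y \<and> \<not> x \<rightarrow>\<^sup>*\<^bsub>pre_digraph.del_vert G v\<^esub> y)"

text \<open>Without \<^locale>\<open>graph\<close>, non-symmetric subdigraphs would compete for maximality.\<close>
definition block :: "('a, 'b) pre_digraph \<Rightarrow> ('a, 'b) pre_digraph \<Rightarrow> bool" where
  "block H G \<longleftrightarrow>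
     pre_digraph.max_subgraph G
       (\<lambda>B. Digraph.graph B \<and> Digraph_Component.connected B \<and> (\<forall>v. \<not> cutvertex B v)) H"

definition complete_multipartite :: "('a, 'b) pre_digraph \<Rightarrow> bool" where
  "complete_multipartite G \<longleftrightarrow> Digraph.graph G \<and>
     (\<exists>P. partition_on (verts G) P \<and>
        (\<forall>u\<in>verts G. \<forall>v\<in>verts G. u \<rightarrow>\<^bsub>G\<^esub> v \<longleftrightarrow> \<not> (\<exists>A\<in>P. u \<in> A \<and> v \<in> A)))"

text \<open>Empty sides are allowed, so that the one-vertex graph is complete bipartite; a connected
  graph with more than one vertex can only satisfy this with two nonempty sides.\<close>
definition complete_bipartite :: "('a, 'b) pre_digraph \<Rightarrow> bool" where
  "complete_bipartite G \<longleftrightarrow> (\<exists>m n. complete_bipartite_digraph m n G)"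

definition bipartite :: "('a, 'b) pre_digraph \<Rightarrow> bool" where
  "bipartite G \<longleftrightarrow>
     (\<exists>U W. verts G = U \<union> W \<and> U \<inter> W = {} \<and> arcs_ends G \<subseteq> U \<times> W \<union> W \<times> U)"

end

theory Submission
  imports Defs "HOL-Library.Sublist"
begin

text \<open>
  For odd \<open>k\<close>, an exact \<open>k\<close>-leaf power is bipartite because trees are: adjacent vertices are leaves
  at odd distance, so they have different colours in a two-colouring of the tree
  (\<open>odd_exact_leaf_power_bipartite\<close>).

  For the converse and for even \<open>k\<close>, a tree is constructed.  Call a vertex set nonseparable if it
  induces a connected subgraph without cutvertices.  A connected graph arises from its nonseparable
  sets by gluing at single vertices (\<open>nonseparable_induct\<close>), and every nonseparable set lies in a
  block (\<open>nonseparable_in_block\<close>), so it inherits the property that non-adjacency is an equivalence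
  relation.  A nonseparable set with at least two vertices is represented by a subdivided star: for
  odd \<open>k\<close> and a complete bipartite graph, the leaf distances are \<open>k - 1\<close>, \<open>k\<close> and \<open>k + 1\<close>; for even
  \<open>k\<close> and a complete multipartite graph, they are \<open>k - 2\<close> and \<open>k\<close>, where the vertices of one part
  share the first edge of their paths from the centre.  In both cases a tree for the whole graph is
  obtained by identifying the pendant edges of the common leaf \<open>c\<close> of two trees
  (\<open>inner_tree_glue\<close>).  If all leaf distances are at least \<open>m\<close>, then two leaves from different
  sides of \<open>c\<close> are at distance at least \<open>2 * m - 2\<close> after gluing.  This is larger than \<open>k\<close> for
  \<open>m = k - 1\<close> and \<open>k \<ge> 5\<close>, and for \<open>m = k - 2\<close> and \<open>k \<ge> 8\<close>, which is where the bounds on \<open>k\<close>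
  come from.  The bound \<open>m\<close> itself is preserved, so that gluing can be iterated.

  In the construction the leaves are attached last: the trees to be glued consist of the remaining
  vertices only, with a map that says where each leaf hangs, and gluing is identification of one
  vertex.  Trees are described by their distance functions (\<open>tree_metric\<close>), for which gluing is a
  case distinction; the subdivided stars are trees of prefixes of words.

  The same induction over nonseparable sets shows that trees are two-colourable and that a
  connected graph is bipartite if its blocks are complete bipartite.
\<close>

section \<open>Trees given by their distances\<close>

text \<open>
  A finite tree is represented by its vertex set, its edge relation and its distance function.  The
  last condition says that a walk from \<open>v\<close> towards \<open>u\<close> has exactly one first step that does not
  lead away from \<open>u\<close>.  Existence of this step makes \<open>d\<close> the graph distance of a connected graph;
  uniqueness excludes cycles, since on a cycle the vertex farthest from \<open>u\<close> would have two such
  steps.  All properties are local, so that they are easily checked when trees are combined.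
\<close>
definition tree_metric :: "'v set \<Rightarrow> ('v \<times> 'v) set \<Rightarrow> ('v \<Rightarrow> 'v \<Rightarrow> nat) \<Rightarrow> bool" where
  "tree_metric W E d \<longleftrightarrow> finite W \<and> E \<subseteq> W \<times> W \<and> sym E \<and>
     (\<forall>u\<in>W. d u u = 0) \<and> (\<forall>u v. (u, v) \<in> E \<longrightarrow> d u v = 1) \<and>
     (\<forall>u\<in>W. \<forall>v\<in>W. u \<noteq> v \<longrightarrow>
        (\<exists>v'. (v, v') \<in> E \<and> d u v = Suc (d u v') \<and>
           (\<forall>v''. (v, v'') \<in> E \<and> v'' \<noteq> v' \<longrightarrow> d u v'' = Suc (d u v))))"

lemma tree_metricI:
  assumes "finite W" "E \<subseteq> W \<times> W" "sym E" "\<And>u. u \<in> W \<Longrightarrow> d u u = 0"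
    "\<And>u v. (u, v) \<in> E \<Longrightarrow> d u v = 1"
    "\<And>u v. u \<in> W \<Longrightarrow> v \<in> W \<Longrightarrow> u \<noteq> v \<Longrightarrow>
        \<exists>v'. (v, v') \<in> E \<and> d u v = Suc (d u v') \<and>
           (\<forall>v''. (v, v'') \<in> E \<and> v'' \<noteq> v' \<longrightarrow> d u v'' = Suc (d u v))"
  shows "tree_metric W E d"
  using assms unfolding tree_metric_def by blast

lemma tree_metricD:
  assumes "tree_metric W E d"
  shows "finite W" "E \<subseteq> W \<times> W" "sym E" "\<And>u. u \<in> W \<Longrightarrow> d u u = 0"
    "\<And>u v. (u, v) \<in> E \<Longrightarrow> d u v = 1"
    "\<And>u v. u \<in> W \<Longrightarrow> v \<in> W \<Longrightarrow> u \<noteq> v \<Longrightarrow>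
        \<exists>v'. (v, v') \<in> E \<and> d u v = Suc (d u v') \<and>
           (\<forall>v''. (v, v'') \<in> E \<and> v'' \<noteq> v' \<longrightarrow> d u v'' = Suc (d u v))"
  using assms unfolding tree_metric_def by blast+

lemma tree_metric_descend:
  assumes "tree_metric W E d" "u \<in> W" "v \<in> W" "u \<noteq> v"
  obtains v' where "(v, v') \<in> E" "d u v = Suc (d u v')"
    "\<And>v''. (v, v'') \<in> E \<Longrightarrow> v'' \<noteq> v' \<Longrightarrow> d u v'' = Suc (d u v)"
  using tree_metricD(6)[OF assms] by blast

lemma tree_metric_step_le:
  assumes "tree_metric W E d" "u \<in> W" "(v, v') \<in> E"
  shows "d u v' \<le> Suc (d u v)"
proof (cases "u = v")
  case True
  then show ?thesis using tree_metricD(5)[OF assms(1), of v v'] assms by simp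
next
  case False
  have "v \<in> W" using tree_metricD(2)[OF assms(1)] assms(3) by blast
  from tree_metric_descend[OF assms(1,2) this False] show ?thesis
    by (metis assms(3) le_SucI nat_le_linear not_less_eq_eq)
qed

lemma tree_metric_rename:
  assumes T: "tree_metric W E d" and inj: "inj_on \<phi> W"
  shows "tree_metric (\<phi> ` W) (map_prod \<phi> \<phi> ` E)
           (\<lambda>x y. d (inv_into W \<phi> x) (inv_into W \<phi> y))"
proof (rule tree_metricI)
  note D = tree_metricD[OF T]
  have inv: "inv_into W \<phi> (\<phi> x) = x" if "x \<in> W" for x using inj that by simp
  have EW: "(x, y) \<in> E \<Longrightarrow> x \<in> W \<and> y \<in> W" for x y using D(2) by blast
  show "finite (\<phi> ` W)" using D(1) by simp
  show "map_prod \<phi> \<phi> ` E \<subseteq> \<phi> ` W \<times> \<phi> ` W" using D(2) by auto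
  show "sym (map_prod \<phi> \<phi> ` E)" using D(3) unfolding sym_def by auto
  show "d (inv_into W \<phi> u) (inv_into W \<phi> u) = 0" if "u \<in> \<phi> ` W" for u
    using that inv D(4) by auto
  show "d (inv_into W \<phi> u) (inv_into W \<phi> v) = 1" if "(u, v) \<in> map_prod \<phi> \<phi> ` E" for u v
    using that inv D(5) EW by fastforce
  fix u v assume "u \<in> \<phi> ` W" "v \<in> \<phi> ` W" "u \<noteq> v"
  then obtain x y where xy: "x \<in> W" "y \<in> W" "x \<noteq> y" "u = \<phi> x" "v = \<phi> y" by auto
  from tree_metric_descend[OF T xy(1-3)] obtain y' where
    y': "(y, y') \<in> E" "d x y = Suc (d x y')"
    "\<And>v''. (y, v'') \<in> E \<Longrightarrow> v'' \<noteq> y' \<Longrightarrow> d x v'' = Suc (d x y)" by metis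
  have nb: "\<exists>z. (y, z) \<in> E \<and> w = \<phi> z" if "(v, w) \<in> map_prod \<phi> \<phi> ` E" for w
    using that xy(2,5) inj EW by (auto dest!: inj_onD)
  show "\<exists>v'. (v, v') \<in> map_prod \<phi> \<phi> ` E \<and>
            d (inv_into W \<phi> u) (inv_into W \<phi> v) = Suc (d (inv_into W \<phi> u) (inv_into W \<phi> v')) \<and>
            (\<forall>v''. (v, v'') \<in> map_prod \<phi> \<phi> ` E \<and> v'' \<noteq> v' \<longrightarrow>
                   d (inv_into W \<phi> u) (inv_into W \<phi> v'') = Suc (d (inv_into W \<phi> u) (inv_into W \<phi> v)))"
  proof (intro exI[of _ "\<phi> y'"] conjI allI impI)
    show "(v, \<phi> y') \<in> map_prod \<phi> \<phi> ` E" using y'(1) xy(5) by force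
    show "d (inv_into W \<phi> u) (inv_into W \<phi> v) = Suc (d (inv_into W \<phi> u) (inv_into W \<phi> (\<phi> y')))"
      using y' xy inv EW by auto
    fix w assume "(v, w) \<in> map_prod \<phi> \<phi> ` E \<and> w \<noteq> \<phi> y'"
    with nb obtain z where "(y, z) \<in> E" "w = \<phi> z" "z \<noteq> y'" by blast
    then show "d (inv_into W \<phi> u) (inv_into W \<phi> w) = Suc (d (inv_into W \<phi> u) (inv_into W \<phi> v))"
      using y'(3) xy inv EW by auto
  qed
qed

text \<open>
  Gluing two trees at one common vertex \<open>q\<close> gives a tree: every path from one side to the other
  passes through \<open>q\<close>, so that all descending steps are inherited from the two parts.
\<close>
lemma tree_metric_glue:
  assumes T1: "tree_metric W1 E1 d1" and T2: "tree_metric W2 E2 d2" and q: "W1 \<inter> W2 = {q}"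
    and d11: "\<And>x y. x \<in> W1 \<Longrightarrow> y \<in> W1 \<Longrightarrow> d x y = d1 x y"
    and d22: "\<And>x y. x \<in> W2 \<Longrightarrow> y \<in> W2 \<Longrightarrow> d x y = d2 x y"
    and d12: "\<And>x y. x \<in> W1 \<Longrightarrow> y \<in> W2 \<Longrightarrow> d x y = d1 x q + d2 q y"
    and d21: "\<And>x y. x \<in> W2 \<Longrightarrow> y \<in> W1 \<Longrightarrow> d x y = d2 x q + d1 q y"
  shows "tree_metric (W1 \<union> W2) (E1 \<union> E2) d" (is "tree_metric ?W ?E d")
proof (rule tree_metricI)
  note D1 = tree_metricD[OF T1] and D2 = tree_metricD[OF T2]
  have qW: "q \<in> W1" "q \<in> W2" using q by auto
  have E1: "(x, y) \<in> E1 \<Longrightarrow> x \<in> W1 \<and> y \<in> W1" for x y using D1(2) by blast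
  have E2: "(x, y) \<in> E2 \<Longrightarrow> x \<in> W2 \<and> y \<in> W2" for x y using D2(2) by blast
  have both: "x \<in> W1 \<Longrightarrow> x \<in> W2 \<Longrightarrow> x = q" for x using q by auto
  show "finite ?W" using D1(1) D2(1) by simp
  show "?E \<subseteq> ?W \<times> ?W" using D1(2) D2(2) by auto
  show "sym ?E" using D1(3) D2(3) by (rule sym_Un)
  show "d u u = 0" if "u \<in> ?W" for u using that D1(4) D2(4) d11 d22 by auto
  show "d u v = 1" if "(u, v) \<in> ?E" for u v
    using that
  proof
    assume "(u, v) \<in> E1" then show ?thesis using d11 E1 D1(5) by simp
  next
    assume "(u, v) \<in> E2" then show ?thesis using d22 E2 D2(5) by metis
  qed
  fix u v assume uv: "u \<in> ?W" "v \<in> ?W" "u \<noteq> v"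
  let ?goal = "\<exists>v'. (v, v') \<in> ?E \<and> d u v = Suc (d u v') \<and>
              (\<forall>v''. (v, v'') \<in> ?E \<and> v'' \<noteq> v' \<longrightarrow> d u v'' = Suc (d u v))"
  have goalI: ?goal if "(v, v') \<in> ?E" "d u v = Suc (d u v')"
     "\<And>w. (v, w) \<in> E1 \<Longrightarrow> w \<noteq> v' \<Longrightarrow> d u w = Suc (d u v)"
     "\<And>w. (v, w) \<in> E2 \<Longrightarrow> w \<noteq> v' \<Longrightarrow> d u w = Suc (d u v)" for v'
    using that by (intro exI[of _ v']) blast
  consider (11) "u \<in> W1" "v \<in> W1" | (12) "u \<in> W1" "v \<in> W2" "v \<notin> W1"
    | (22) "u \<in> W2" "v \<in> W2" | (21) "u \<in> W2" "v \<in> W1" "v \<notin> W2" using uv by blast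
  then show ?goal
  proof cases
    case 11
    from tree_metric_descend[OF T1 11 uv(3)] obtain v' where
      v': "(v, v') \<in> E1" "d1 u v = Suc (d1 u v')"
      "\<And>w. (v, w) \<in> E1 \<Longrightarrow> w \<noteq> v' \<Longrightarrow> d1 u w = Suc (d1 u v)" by metis
    show ?thesis
    proof (rule goalI[of v'])
      show "(v, v') \<in> ?E" using v' by simp
      show "d u v = Suc (d u v')" using v'(1,2) E1 11 d11 by simp
      show "d u w = Suc (d u v)" if "(v, w) \<in> E1" "w \<noteq> v'" for w
        using v'(3)[OF that] that E1 11 d11 by simp
      show "d u w = Suc (d u v)" if "(v, w) \<in> E2" "w \<noteq> v'" for w
      proof -
        have "v = q" "w \<in> W2" using that E2 both 11 by blast+
        then show ?thesis using d12[OF 11(1) \<open>w \<in> W2\<close>] d11[OF 11] D2(5)[of q w] that by simp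
      qed
    qed
  next
    case 22
    from tree_metric_descend[OF T2 22 uv(3)] obtain v' where
      v': "(v, v') \<in> E2" "d2 u v = Suc (d2 u v')"
      "\<And>w. (v, w) \<in> E2 \<Longrightarrow> w \<noteq> v' \<Longrightarrow> d2 u w = Suc (d2 u v)" by metis
    show ?thesis
    proof (rule goalI[of v'])
      show "(v, v') \<in> ?E" using v' by simp
      show "d u v = Suc (d u v')" using v'(1,2) E2 22 d22 by metis
      show "d u w = Suc (d u v)" if "(v, w) \<in> E2" "w \<noteq> v'" for w
        using v'(3)[OF that] that E2 22 d22 by metis
      show "d u w = Suc (d u v)" if "(v, w) \<in> E1" "w \<noteq> v'" for w
      proof -
        have "v = q" "w \<in> W1" using that E1 both 22 by blast+
        then show ?thesis using d21[OF 22(1) \<open>w \<in> W1\<close>] d22[OF 22] D1(5)[of q w] that by simp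
      qed
    qed
  next
    case 12
    then have "q \<noteq> v" using qW by auto
    from tree_metric_descend[OF T2 qW(2) 12(2) this] obtain v' where
      v': "(v, v') \<in> E2" "d2 q v = Suc (d2 q v')"
      "\<And>w. (v, w) \<in> E2 \<Longrightarrow> w \<noteq> v' \<Longrightarrow> d2 q w = Suc (d2 q v)" by metis
    show ?thesis
    proof (rule goalI[of v'])
      show "(v, v') \<in> ?E" using v' by simp
      show "d u v = Suc (d u v')" using d12[of u v] d12[of u v'] v'(1,2) E2 12 by simp
      show "d u w = Suc (d u v)" if "(v, w) \<in> E2" "w \<noteq> v'" for w
        using v'(3)[OF that] that E2 12 d12[of u v] d12[of u w] by simp
      show "d u w = Suc (d u v)" if "(v, w) \<in> E1" "w \<noteq> v'" for w
        using E1 that 12 by blast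
    qed
  next
    case 21
    then have "q \<noteq> v" using qW by auto
    from tree_metric_descend[OF T1 qW(1) 21(2) this] obtain v' where
      v': "(v, v') \<in> E1" "d1 q v = Suc (d1 q v')"
      "\<And>w. (v, w) \<in> E1 \<Longrightarrow> w \<noteq> v' \<Longrightarrow> d1 q w = Suc (d1 q v)" by metis
    show ?thesis
    proof (rule goalI[of v'])
      show "(v, v') \<in> ?E" using v' by simp
      show "d u v = Suc (d u v')" using d21[of u v] d21[of u v'] v'(1,2) E1 21 by simp
      show "d u w = Suc (d u v)" if "(v, w) \<in> E1" "w \<noteq> v'" for w
        using v'(3)[OF that] that E1 21 d21[of u v] d21[of u w] by simp
      show "d u w = Suc (d u v)" if "(v, w) \<in> E2" "w \<noteq> v'" for w
        using E2 that 21 by blast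
    qed
  qed
qed

section \<open>The tree of prefixes of a set of words\<close>

text \<open>
  The distance of two words in the tree in which every nonempty word is joined to the word without
  its last letter: both words are walked up to their longest common prefix.
\<close>
fun word_dist :: "'b list \<Rightarrow> 'b list \<Rightarrow> nat" where
  "word_dist [] ys = length ys"
| "word_dist (x # xs) [] = Suc (length xs)"
| "word_dist (x # xs) (y # ys) = (if x = y then word_dist xs ys else length xs + length ys + 2)"

definition word_step :: "'b list \<Rightarrow> 'b list \<Rightarrow> bool" where
  "word_step v w \<longleftrightarrow> (\<exists>b. w = v @ [b]) \<or> (\<exists>b. v = w @ [b])"

lemma word_step_Nil [simp]: "word_step [] w \<longleftrightarrow> (\<exists>b. w = [b])"
  by (auto simp: word_step_def)

lemma word_step_Cons_Cons [simp]: "word_step (x # v) (x # w) \<longleftrightarrow> word_step v w"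
  by (auto simp: word_step_def)

lemma word_step_Cons:
  "word_step (x # v) w \<longleftrightarrow> (v = [] \<and> w = []) \<or> (\<exists>w'. w = x # w' \<and> word_step v w')"
  by (cases w) (auto simp: word_step_def append_eq_Cons_conv)

lemma word_dist_refl [simp]: "word_dist u u = 0"
  by (induction u) auto

lemma word_dist_Nil2 [simp]: "word_dist u [] = length u"
  by (cases u) auto

lemma word_dist_step: "word_step u v \<Longrightarrow> word_dist u v = 1"
proof (induction u v rule: word_dist.induct)
  case (3 x xs y ys)
  then show ?case by (auto simp: word_step_Cons)
qed (auto simp: word_step_Cons)

text \<open>
  The neighbour of \<open>v\<close> towards \<open>u\<close> is the parent of \<open>v\<close>, unless \<open>v\<close> is a proper prefix of \<open>u\<close>; then
  it is the prefix of \<open>u\<close> that is longer by one letter.  In both cases it lies in every prefix-closed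
  set containing \<open>u\<close> and \<open>v\<close>, which is why this information is part of the conclusion.
\<close>
lemma word_descend:
  assumes "u \<noteq> v"
  shows "\<exists>v'. word_step v v' \<and> (v' = butlast v \<or> prefix v' u) \<and>
           word_dist u v = Suc (word_dist u v') \<and>
           (\<forall>v''. word_step v v'' \<and> v'' \<noteq> v' \<longrightarrow> word_dist u v'' = Suc (word_dist u v))"
  using assms
proof (induction u v rule: word_dist.induct)
  case (1 v)
  then obtain w b where v: "v = w @ [b]" by (metis rev_exhaust)
  then show ?case by (intro exI[of _ w]) (auto simp: word_step_def)
next
  case (2 x xs)
  show ?case by (intro exI[of _ "[x]"]) (auto split: if_splits)
next
  case (3 x xs y ys)
  show ?case
  proof (cases "x = y")
    case True
    with 3 obtain v' where v': "word_step ys v'" "v' = butlast ys \<or> prefix v' xs"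
      "word_dist xs ys = Suc (word_dist xs v')"
      "\<And>v''. word_step ys v'' \<Longrightarrow> v'' \<noteq> v' \<Longrightarrow> word_dist xs v'' = Suc (word_dist xs ys)"
      by auto
    have "word_dist (x # xs) w = Suc (word_dist xs ys)"
      if "word_step (x # ys) w" "w \<noteq> x # v'" for w
      using that v'(4) by (cases w) (auto simp: word_step_Cons)
    moreover have "x # v' = butlast (x # ys) \<or> prefix (x # v') (x # xs)"
      using v'(1,2) by auto
    ultimately show ?thesis using True v' by (intro exI[of _ "x # v'"]) auto
  next
    case False
    obtain w b where w: "y # ys = w @ [b]" by (metis list.distinct(1) rev_exhaust)
    show ?thesis
    proof (cases w)
      case Nil
      then have "ys = []" using w by simp
      then show ?thesis using False by (intro exI[of _ "[]"]) (auto simp: word_step_Cons)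
    next
      case (Cons y' w')
      then have [simp]: "ys = w' @ [b]" "y' = y" using w by auto
      show ?thesis using False
        by (intro exI[of _ "y # w'"]) (auto simp: word_step_Cons butlast_append word_step_def)
    qed
  qed
qed

lemma tree_metric_words:
  assumes fin: "finite W" and closed: "\<And>v w. w \<in> W \<Longrightarrow> prefix v w \<Longrightarrow> v \<in> W"
  shows "tree_metric W {(v, w). v \<in> W \<and> w \<in> W \<and> word_step v w} word_dist"
proof (rule tree_metricI)
  show "sym {(v, w). v \<in> W \<and> w \<in> W \<and> word_step v w}"
    by (auto simp: sym_def word_step_def)
  fix u v assume uv: "u \<in> W" "v \<in> W" "u \<noteq> v"
  from word_descend[OF uv(3)] obtain v' where
    v': "word_step v v'" "v' = butlast v \<or> prefix v' u" "word_dist u v = Suc (word_dist u v')"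
    "\<And>v''. word_step v v'' \<Longrightarrow> v'' \<noteq> v' \<Longrightarrow> word_dist u v'' = Suc (word_dist u v)" by blast
  have "v' \<in> W" using v'(2) closed uv(1,2) prefixeq_butlast by blast
  then show "\<exists>v'. (v, v') \<in> {(v, w). v \<in> W \<and> w \<in> W \<and> word_step v w} \<and>
            word_dist u v = Suc (word_dist u v') \<and>
            (\<forall>v''. (v, v'') \<in> {(v, w). v \<in> W \<and> w \<in> W \<and> word_step v w} \<and> v'' \<noteq> v' \<longrightarrow>
                   word_dist u v'' = Suc (word_dist u v))"
    using v' uv by (intro exI[of _ v']) auto
qed (use fin word_dist_step in auto)

section \<open>Trees to which the leaves are still to be attached\<close>

text \<open>
  The tree that remains when the leaves of an exact leaf root on \<open>S\<close> are deleted: leaf \<open>u\<close> hangs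
  at the vertex \<open>a u\<close>.  The degree condition guarantees that every vertex has at least two neighbours
  once the leaves are attached, so that no vertex of this tree becomes a leaf (for \<open>M > 0\<close>, distinct
  leaves hang at distinct vertices).  Attaching the leaves raises distances by 2, hence \<open>K\<close> stands
  for \<open>k - 2\<close>.  The lower bound \<open>M\<close> on the distances is the invariant needed for gluing.
\<close>
definition inner_tree :: "nat \<Rightarrow> nat \<Rightarrow> ('a \<Rightarrow> 'a \<Rightarrow> bool) \<Rightarrow> 'a set \<Rightarrow>
    'v set \<Rightarrow> ('v \<times> 'v) set \<Rightarrow> ('v \<Rightarrow> 'v \<Rightarrow> nat) \<Rightarrow> ('a \<Rightarrow> 'v) \<Rightarrow> bool" where
  "inner_tree K M adj S W E d a \<longleftrightarrow> tree_metric W E d \<and> a ` S \<subseteq> W \<and>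
     (\<forall>p\<in>W. \<exists>p'. (p, p') \<in> E \<and> (p \<in> a ` S \<or> (\<exists>p''. (p, p'') \<in> E \<and> p'' \<noteq> p'))) \<and>
     (\<forall>u\<in>S. \<forall>v\<in>S. u \<noteq> v \<longrightarrow> M \<le> d (a u) (a v) \<and> (d (a u) (a v) = K \<longleftrightarrow> adj u v))"

lemma inner_tree_rename:
  assumes T: "inner_tree K M adj S W E d a" and inj: "inj_on \<phi> W"
  shows "inner_tree K M adj S (\<phi> ` W) (map_prod \<phi> \<phi> ` E)
           (\<lambda>x y. d (inv_into W \<phi> x) (inv_into W \<phi> y)) (\<phi> \<circ> a)"
    (is "inner_tree K M adj S ?W ?E ?d ?a")
proof -
  have tm: "tree_metric W E d" and aW: "a ` S \<subseteq> W"
    and deg: "\<And>p. p \<in> W \<Longrightarrow> \<exists>p'. (p, p') \<in> E \<and> (p \<in> a ` S \<or> (\<exists>p''. (p, p'') \<in> E \<and> p'' \<noteq> p'))"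
    and dist: "\<And>u v. u \<in> S \<Longrightarrow> v \<in> S \<Longrightarrow> u \<noteq> v \<Longrightarrow> M \<le> d (a u) (a v) \<and> (d (a u) (a v) = K \<longleftrightarrow> adj u v)"
    using T unfolding inner_tree_def by blast+
  have EW: "E \<subseteq> W \<times> W" using tree_metricD(2)[OF tm] .
  have "tree_metric ?W ?E ?d" using tm inj by (rule tree_metric_rename)
  moreover have "?a ` S \<subseteq> ?W" using aW by auto
  moreover have "\<exists>p'. (q, p') \<in> ?E \<and> (q \<in> ?a ` S \<or> (\<exists>p''. (q, p'') \<in> ?E \<and> p'' \<noteq> p'))"
    if q: "q \<in> ?W" for q
  proof -
    from q obtain p where p: "p \<in> W" "q = \<phi> p" by auto
    from deg[OF p(1)] obtain p' where
      p': "(p, p') \<in> E" "p \<in> a ` S \<or> (\<exists>p''. (p, p'') \<in> E \<and> p'' \<noteq> p')" by blast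
    have ne: "\<phi> p'' \<noteq> \<phi> p'" if "(p, p'') \<in> E" "p'' \<noteq> p'" for p''
      using that p'(1) EW inj by (meson inj_onD mem_Sigma_iff subsetD)
    have img: "(q, \<phi> r) \<in> ?E" if "(p, r) \<in> E" for r using that p(2) by force
    have "q \<in> ?a ` S \<or> (\<exists>p''. (q, p'') \<in> ?E \<and> p'' \<noteq> \<phi> p')" (is ?other)
      using p'(2) img ne p(2) by (metis image_comp image_eqI)
    with img[OF p'(1)] have "(q, \<phi> p') \<in> ?E \<and> ?other" by (rule conjI)
    then show ?thesis by (rule exI)
  qed
  moreover have "M \<le> ?d (?a u) (?a v) \<and> (?d (?a u) (?a v) = K \<longleftrightarrow> adj u v)"
    if "u \<in> S" "v \<in> S" "u \<noteq> v" for u v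
  proof -
    have "inv_into W \<phi> (?a w) = a w" if "w \<in> S" for w using that aW inj by auto
    then show ?thesis using dist[OF that] that by simp
  qed
  ultimately show ?thesis unfolding inner_tree_def by (intro conjI ballI impI) simp_all
qed

text \<open>
  Two inner trees are glued by identifying the two vertices at which the common leaf \<open>c\<close> hangs.  A
  leaf from one side and a leaf from the other side, both different from \<open>c\<close>, then are at distance
  at least \<open>2 * M\<close>, which exceeds \<open>K\<close>: no adjacency across \<open>c\<close> is created.
\<close>
lemma inner_tree_glue:
  assumes T1: "inner_tree K M adj A W1 E1 d1 a1" and T2: "inner_tree K M adj B W2 E2 d2 a2"
    and AB: "A \<inter> B = {c}" and W: "W1 \<inter> W2 = {q}"
    and aA: "\<And>x. x \<in> A \<Longrightarrow> a x = a1 x" and aB: "\<And>x. x \<in> B \<Longrightarrow> a x = a2 x" and aq: "a c = q"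
    and d11: "\<And>x y. x \<in> W1 \<Longrightarrow> y \<in> W1 \<Longrightarrow> d x y = d1 x y"
    and d22: "\<And>x y. x \<in> W2 \<Longrightarrow> y \<in> W2 \<Longrightarrow> d x y = d2 x y"
    and d12: "\<And>x y. x \<in> W1 \<Longrightarrow> y \<in> W2 \<Longrightarrow> d x y = d1 x q + d2 q y"
    and d21: "\<And>x y. x \<in> W2 \<Longrightarrow> y \<in> W1 \<Longrightarrow> d x y = d2 x q + d1 q y"
    and far: "K < 2 * M"
    and nadj: "\<And>x y. x \<in> A - {c} \<Longrightarrow> y \<in> B - {c} \<Longrightarrow> \<not> adj x y \<and> \<not> adj y x"
  shows "inner_tree K M adj (A \<union> B) (W1 \<union> W2) (E1 \<union> E2) d a"
proof -
  have tm1: "tree_metric W1 E1 d1" and aW1: "a1 ` A \<subseteq> W1"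
    and deg1: "\<And>p. p \<in> W1 \<Longrightarrow> \<exists>p'. (p, p') \<in> E1 \<and> (p \<in> a1 ` A \<or> (\<exists>p''. (p, p'') \<in> E1 \<and> p'' \<noteq> p'))"
    and dist1: "\<And>u v. u \<in> A \<Longrightarrow> v \<in> A \<Longrightarrow> u \<noteq> v \<Longrightarrow> M \<le> d1 (a1 u) (a1 v) \<and> (d1 (a1 u) (a1 v) = K \<longleftrightarrow> adj u v)"
    using T1 unfolding inner_tree_def by blast+
  have tm2: "tree_metric W2 E2 d2" and aW2: "a2 ` B \<subseteq> W2"
    and deg2: "\<And>p. p \<in> W2 \<Longrightarrow> \<exists>p'. (p, p') \<in> E2 \<and> (p \<in> a2 ` B \<or> (\<exists>p''. (p, p'') \<in> E2 \<and> p'' \<noteq> p'))"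
    and dist2: "\<And>u v. u \<in> B \<Longrightarrow> v \<in> B \<Longrightarrow> u \<noteq> v \<Longrightarrow> M \<le> d2 (a2 u) (a2 v) \<and> (d2 (a2 u) (a2 v) = K \<longleftrightarrow> adj u v)"
    using T2 unfolding inner_tree_def by blast+
  have cA: "c \<in> A" "c \<in> B" using AB by auto
  have im: "a ` (A \<union> B) = a1 ` A \<union> a2 ` B" using aA aB by (simp add: image_Un)
  have tm: "tree_metric (W1 \<union> W2) (E1 \<union> E2) d"
    using tree_metric_glue[OF tm1 tm2 W d11 d22 d12 d21] .
  have deg: "\<exists>p'. (p, p') \<in> E1 \<union> E2 \<and> (p \<in> a ` (A \<union> B) \<or> (\<exists>p''. (p, p'') \<in> E1 \<union> E2 \<and> p'' \<noteq> p'))"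
    if "p \<in> W1 \<union> W2" for p
    using that
  proof
    assume "p \<in> W1"
    from deg1[OF this] show ?thesis unfolding im by blast
  next
    assume "p \<in> W2"
    from deg2[OF this] show ?thesis unfolding im by blast
  qed
  have cross: "2 * M \<le> d (a u) (a v) \<and> 2 * M \<le> d (a v) (a u)" if "u \<in> A - {c}" "v \<in> B - {c}" for u v
  proof -
    have "a u \<in> W1" "a v \<in> W2" using that aA aB aW1 aW2 by auto
    moreover have "M \<le> d1 (a u) q" "M \<le> d1 q (a u)"
      using dist1[of u c] dist1[of c u] that cA aA aq by auto
    moreover have "M \<le> d2 (a v) q" "M \<le> d2 q (a v)"
      using dist2[of v c] dist2[of c v] that cA aB aq by auto
    ultimately show ?thesis using d12[of "a u" "a v"] d21[of "a v" "a u"] by auto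
  qed
  have dist: "M \<le> d (a u) (a v) \<and> (d (a u) (a v) = K \<longleftrightarrow> adj u v)"
    if uv: "u \<in> A \<union> B" "v \<in> A \<union> B" "u \<noteq> v" for u v
  proof -
    consider (11) "u \<in> A" "v \<in> A" | (22) "u \<in> B" "v \<in> B"
      | (12) "u \<in> A - {c}" "v \<in> B - {c}" | (21) "u \<in> B - {c}" "v \<in> A - {c}"
      using uv cA by blast
    then show ?thesis
    proof cases
      case 11
      then have "d (a u) (a v) = d1 (a1 u) (a1 v)" using aA aW1 d11 by (simp add: image_subset_iff)
      then show ?thesis using dist1[OF 11 uv(3)] by simp
    next
      case 22
      then have "d (a u) (a v) = d2 (a2 u) (a2 v)" using aB aW2 d22 by (simp add: image_subset_iff)
      then show ?thesis using dist2[OF 22 uv(3)] by simp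
    next
      case 12
      then show ?thesis using cross[of u v] nadj[of u v] far by auto
    next
      case 21
      then show ?thesis using cross[of v u] nadj[of v u] far by auto
    qed
  qed
  show ?thesis
    unfolding inner_tree_def using tm aW1 aW2 im deg dist by auto
qed

definition has_inner_tree :: "nat \<Rightarrow> nat \<Rightarrow> ('a \<Rightarrow> 'a \<Rightarrow> bool) \<Rightarrow> 'a set \<Rightarrow> bool" where
  "has_inner_tree K M adj S \<longleftrightarrow> (\<exists>(W :: nat set) E d a. inner_tree K M adj S W E d a)"

text \<open>
  Renaming makes the type of the inner vertices irrelevant, as long as it has room for fresh ones.
\<close>
lemma has_inner_treeI:
  assumes "inner_tree K M adj S W E d a"
  shows "has_inner_tree K M adj S"
proof -
  have "finite W" using assms tree_metricD(1) unfolding inner_tree_def by blast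
  then obtain \<phi> :: "_ \<Rightarrow> nat" where "inj_on \<phi> W" using finite_imp_inj_to_nat_seg by metis
  then show ?thesis using inner_tree_rename[OF assms] unfolding has_inner_tree_def by blast
qed

lemma has_inner_tree_glue:
  assumes T1: "has_inner_tree K M adj A" and T2: "has_inner_tree K M adj B"
    and AB: "A \<inter> B = {c}" and far: "K < 2 * M"
    and nadj: "\<And>x y. x \<in> A - {c} \<Longrightarrow> y \<in> B - {c} \<Longrightarrow> \<not> adj x y \<and> \<not> adj y x"
  shows "has_inner_tree K M adj (A \<union> B)"
proof -
  from T1 T2 obtain W1 W2 :: "nat set" and E1 E2 d1 d2 a1 a2 where
    t1: "inner_tree K M adj A W1 E1 d1 a1" and t2: "inner_tree K M adj B W2 E2 d2 a2"
    unfolding has_inner_tree_def by blast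
  have fin: "finite W1" using t1 tree_metricD(1) unfolding inner_tree_def by blast
  \<comment> \<open>Move the second tree away from the first one, except that the vertex below \<open>c\<close> is shared.\<close>
  define \<phi> where "\<phi> p = (if p = a2 c then a1 c else p + Suc (Max W1))" for p
  have c: "a1 c \<in> W1" "a2 c \<in> W2" using t1 t2 AB unfolding inner_tree_def by auto
  have fresh: "p + Suc (Max W1) \<notin> W1" for p
  proof
    assume "p + Suc (Max W1) \<in> W1"
    from Max_ge[OF fin this] show False by simp
  qed
  have "inj_on \<phi> W2"
    unfolding inj_on_def \<phi>_def using fresh c by (metis add_right_cancel)
  from inner_tree_rename[OF t2 this] have t2': "inner_tree K M adj B (\<phi> ` W2) (map_prod \<phi> \<phi> ` E2)
      (\<lambda>x y. d2 (inv_into W2 \<phi> x) (inv_into W2 \<phi> y)) (\<phi> \<circ> a2)" .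
  define d2' where "d2' x y = d2 (inv_into W2 \<phi> x) (inv_into W2 \<phi> y)" for x y
  have int: "W1 \<inter> \<phi> ` W2 = {a1 c}" using c fresh unfolding \<phi>_def by (auto simp: image_iff)
  have tm: "tree_metric W1 E1 d1" "tree_metric (\<phi> ` W2) (map_prod \<phi> \<phi> ` E2) d2'"
    using t1 t2' unfolding inner_tree_def d2'_def by blast+
  have z: "d1 (a1 c) (a1 c) = 0" "d2' (a1 c) (a1 c) = 0"
    by (rule tree_metricD(4)[OF tm(1)], use int in blast)
      (rule tree_metricD(4)[OF tm(2)], use int in blast)
  have both: "x \<in> W1 \<Longrightarrow> x \<in> \<phi> ` W2 \<Longrightarrow> x = a1 c" for x using int by auto
  have cB: "x \<in> A \<Longrightarrow> x \<in> B \<Longrightarrow> x = c" for x using AB by auto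
  have "inner_tree K M adj (A \<union> B) (W1 \<union> \<phi> ` W2) (E1 \<union> map_prod \<phi> \<phi> ` E2)
     (\<lambda>x y. if x \<in> W1 then if y \<in> W1 then d1 x y else d1 x (a1 c) + d2' (a1 c) y
            else if y \<in> \<phi> ` W2 then d2' x y else d2' x (a1 c) + d1 (a1 c) y)
     (\<lambda>x. if x \<in> A then a1 x else (\<phi> \<circ> a2) x)"
  proof (rule inner_tree_glue[OF t1 _ AB int _ _ _ _ _ _ _ far nadj])
    show "inner_tree K M adj B (\<phi> ` W2) (map_prod \<phi> \<phi> ` E2) d2' (\<phi> \<circ> a2)"
      using t2' unfolding d2'_def .
    show "(if x \<in> A then a1 x else (\<phi> \<circ> a2) x) = (\<phi> \<circ> a2) x" if "x \<in> B" for x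
      using cB[of x] that by (auto simp: \<phi>_def)
    let ?d = "\<lambda>x y. if x \<in> W1 then if y \<in> W1 then d1 x y else d1 x (a1 c) + d2' (a1 c) y
            else if y \<in> \<phi> ` W2 then d2' x y else d2' x (a1 c) + d1 (a1 c) y"
    fix x y
    show "?d x y = d2' x y" if "x \<in> \<phi> ` W2" "y \<in> \<phi> ` W2"
      using both[of x] both[of y] that z by auto
    show "?d x y = d1 x (a1 c) + d2' (a1 c) y" if "x \<in> W1" "y \<in> \<phi> ` W2"
      using both[of y] that z by auto
    show "?d x y = d2' x (a1 c) + d1 (a1 c) y" if "x \<in> \<phi> ` W2" "y \<in> W1"
      using both[of x] both[of y] that z by auto
  qed (use AB in auto)
  then show ?thesis unfolding has_inner_tree_def by blast
qed

text \<open>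
  The prefixes of code words form an inner tree: a nonempty proper prefix has a parent and a child,
  a code word has its parent and its leaf, and the empty word has two children because two code
  words differ in their first letter.
\<close>
lemma has_inner_tree_words:
  assumes fin: "finite S" and ne: "\<And>x. x \<in> S \<Longrightarrow> a x \<noteq> []"
    and xy: "x \<in> S" "y \<in> S" "hd (a x) \<noteq> hd (a y)"
    and dist: "\<And>u v. u \<in> S \<Longrightarrow> v \<in> S \<Longrightarrow> u \<noteq> v \<Longrightarrow>
      M \<le> word_dist (a u) (a v) \<and> (word_dist (a u) (a v) = K \<longleftrightarrow> adj u v)"
  shows "has_inner_tree K M adj S"
proof (rule has_inner_treeI)
  let ?W = "\<Union>x\<in>S. set (prefixes (a x))"
  let ?E = "{(v, w). v \<in> ?W \<and> w \<in> ?W \<and> word_step v w}"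
  show "inner_tree K M adj S ?W ?E word_dist a"
    unfolding inner_tree_def
  proof (intro conjI ballI)
    show "tree_metric ?W ?E word_dist"
    proof (rule tree_metric_words)
      show "finite ?W" using fin by simp
    qed (auto intro: prefix_order.trans)
    show "a ` S \<subseteq> ?W" by auto
    fix p assume "p \<in> ?W"
    then obtain s r where s: "s \<in> S" "a s = p @ r" by (auto simp: prefix_def)
    show "\<exists>p'. (p, p') \<in> ?E \<and> (p \<in> a ` S \<or> (\<exists>p''. (p, p'') \<in> ?E \<and> p'' \<noteq> p'))"
    proof (cases "p = []")
      case True
      have "[hd (a z)] \<in> ?W" if "z \<in> S" for z
        using ne[OF that] that by (intro UN_I[of z]) (cases "a z"; auto)+
      moreover have "[] \<in> ?W" using xy by auto
      ultimately show ?thesis using True xy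
        by (intro exI[of _ "[hd (a x)]"]) (auto intro!: exI[of _ "[hd (a y)]"])
    next
      case False
      then obtain q b where p: "p = q @ [b]" by (metis rev_exhaust)
      have "prefix p (a s)" "prefix q (a s)" using s(2) p by auto
      then have "p \<in> ?W" "q \<in> ?W" using s(1) by auto
      moreover have "word_step p q" using p by (auto simp: word_step_def)
      ultimately have qW: "(p, q) \<in> ?E" by blast
      show ?thesis
      proof (cases r)
        case Nil
        then show ?thesis using qW s by force
      next
        case (Cons b' r')
        have "prefix (p @ [b']) (a s)" using s(2) Cons by simp
        then have "p @ [b'] \<in> ?W" using s(1) by auto
        moreover have "word_step p (p @ [b'])" by (auto simp: word_step_def)
        ultimately have "(p, p @ [b']) \<in> ?E" using \<open>p \<in> ?W\<close> by blast
        moreover have "p @ [b'] \<noteq> q" using p by simp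
        ultimately show ?thesis using qW by blast
      qed
    qed
  qed (use dist in blast)
qed

lemma word_dist_replicate:
  assumes "x \<noteq> y"
  shows "word_dist (replicate m x) (replicate n y) = m + n"
  using assms by (cases m; cases n) auto

text \<open>
  A complete bipartite graph for odd \<open>k\<close>: a spider whose legs have length \<open>(k - 1) / 2\<close> on one side
  and \<open>(k - 3) / 2\<close> on the other.  Opposite sides are at distance \<open>k - 2\<close>, equal sides at the
  distances \<open>k - 1\<close> and \<open>k - 3\<close>.
\<close>
lemma has_inner_tree_complete_bipartite:
  assumes fin: "finite S" and k: "odd k" "5 \<le> k"
    and adj: "\<And>x y. x \<in> S \<Longrightarrow> y \<in> S \<Longrightarrow> adj x y \<longleftrightarrow> f x \<noteq> (f y :: bool)"
    and xy: "x \<in> S" "y \<in> S" "x \<noteq> y"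
  shows "has_inner_tree (k - 2) (k - 3) adj S"
proof -
  from k have "even (k - 5)" by simp
  then obtain j where "k - 5 = 2 * j" by blast
  with k(2) have j: "k = 2 * j + 5" by simp
  let ?a = "\<lambda>x. replicate (if f x then j + 2 else j + 1) x"
  show ?thesis
  proof (rule has_inner_tree_words[of S ?a x y])
    show "finite S" using fin .
    show "hd (?a x) \<noteq> hd (?a y)" using xy by simp
    fix u v assume "u \<in> S" "v \<in> S" "u \<noteq> v"
    then show "k - 3 \<le> word_dist (?a u) (?a v) \<and> (word_dist (?a u) (?a v) = k - 2 \<longleftrightarrow> adj u v)"
      using adj[of u v] unfolding word_dist_replicate[OF \<open>u \<noteq> v\<close>] by (auto simp: j)
  qed (use xy in auto)
qed

text \<open>
  A complete multipartite graph for even \<open>k\<close>: all legs of a spider have length \<open>(k - 2) / 2\<close>, and the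
  legs of one part share their first edge.  The first letter of a code word names the part, the
  remaining letters the vertex.  Distances are \<open>k - 2\<close> between parts and \<open>k - 4\<close> inside a part.
\<close>
lemma has_inner_tree_complete_multipartite:
  assumes fin: "finite S" and k: "even k" "4 \<le> k"
    and adj: "\<And>x y :: 'a. x \<in> S \<Longrightarrow> y \<in> S \<Longrightarrow> adj x y \<longleftrightarrow> f x \<noteq> (f y :: 'b)"
    and xy: "x \<in> S" "y \<in> S" "f x \<noteq> f y"
  shows "has_inner_tree (k - 2) (k - 4) adj S"
proof -
  from k have "even (k - 4)" by simp
  then obtain j where "k - 4 = 2 * j" by blast
  with k(2) have j: "k = 2 * j + 4" by simp
  define a where "a x = Inl (f x) # replicate j (Inr x)" for x
  show ?thesis
  proof (rule has_inner_tree_words[of S a x y])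
    show "finite S" using fin .
    fix u v assume "u \<in> S" "v \<in> S" "u \<noteq> v"
    then show "k - 4 \<le> word_dist (a u) (a v) \<and> (word_dist (a u) (a v) = k - 2 \<longleftrightarrow> adj u v)"
      using adj[of u v] word_dist_replicate[of "Inr u :: 'b + 'a" "Inr v" j j] by (auto simp: j a_def)
  qed (use xy in \<open>auto simp: a_def\<close>)
qed

section \<open>Tree metrics are trees with their graph distance\<close>

lemma (in wf_digraph) awalk_verts_step:
  assumes "awalk u p v" "i < length p"
  shows "(awalk_verts u p ! i, awalk_verts u p ! Suc i) \<in> arcs_ends G"
  using assms
proof (induction p arbitrary: u i)
  case (Cons e p)
  then have e: "e \<in> arcs G" "u = tail G e" "awalk (head G e) p v" by (auto simp: awalk_Cons_iff)
  show ?case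
  proof (cases i)
    case 0
    have "awalk_verts (head G e) p ! 0 = head G e"
      using awhd_of_awalk[OF e(3)] by (simp add: hd_conv_nth)
    then show ?thesis using 0 e by (auto simp: arcs_ends_conv)
  next
    case (Suc j)
    then show ?thesis using Cons.IH[OF e(3), of j] Cons.prems(2) by simp
  qed
qed simp

abbreviation pair_graph_of :: "'v set \<Rightarrow> ('v \<times> 'v) set \<Rightarrow> 'v pair_pre_digraph" where
  "pair_graph_of W E \<equiv> \<lparr>pverts = W, parcs = E\<rparr>"

context
  fixes W :: "'v set" and E d
  assumes tm: "tree_metric W E d"
begin

lemma tree_metric_pair_graph: "pair_graph (pair_graph_of W E)"
proof
  note D = tree_metricD[OF tm]
  show "fst e \<in> pverts (pair_graph_of W E)" "snd e \<in> pverts (pair_graph_of W E)"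
    if "e \<in> parcs (pair_graph_of W E)" for e
    using that D(2) by auto
  show "finite (pverts (pair_graph_of W E))" using D(1) by simp
  show "finite (parcs (pair_graph_of W E))" using D(1,2) by (simp add: finite_subset)
  show "fst e \<noteq> snd e" if "e \<in> parcs (pair_graph_of W E)" for e
    using that D(2,4,5) by (cases e) fastforce
  show "symmetric (with_proj (pair_graph_of W E))"
    using D(3) by (simp add: symmetric_def)
qed

interpretation T: pair_graph "pair_graph_of W E" by (rule tree_metric_pair_graph)

lemma tree_metric_walk_ex:
  assumes "u \<in> W" "v \<in> W"
  shows "\<exists>p. T.awalk u p v \<and> length p = d u v"
  using assms(2)
proof (induction "d u v" arbitrary: v)
  case 0
  have "u = v"
  proof (rule ccontr)
    assume "u \<noteq> v"
    from tree_metric_descend[OF tm assms(1) 0(2) this] obtain v' where "d u v = Suc (d u v')" .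
    then show False using 0(1) by simp
  qed
  then have "T.awalk u [] v" using assms(1) by (simp add: T.awalk_Nil_iff)
  then show ?case using 0(1) by (metis list.size(3))
next
  case (Suc n)
  then have "u \<noteq> v" using tree_metricD(4)[OF tm assms(1)] by auto
  then obtain v' where v': "(v, v') \<in> E" "d u v = Suc (d u v')"
    using tree_metric_descend[OF tm assms(1) Suc.prems] by metis
  then have "v' \<in> W" "(v', v) \<in> E"
    using tree_metricD(2)[OF tm] symD[OF tree_metricD(3)[OF tm]] by blast+
  with Suc.hyps(1)[of v'] Suc.hyps(2) v'(2) obtain p where "T.awalk u p v'" "length p = d u v'" by auto
  then have "T.awalk u (p @ [(v', v)]) v"
    using \<open>(v', v) \<in> E\<close> \<open>v \<in> W\<close> by (auto simp: T.awalk_simps)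
  then show ?case using v'(2) \<open>length p = d u v'\<close> by (intro exI[of _ "p @ [(v', v)]"]) simp
qed

lemma tree_metric_walk_le:
  assumes "u \<in> W" "T.awalk x p v"
  shows "d u v \<le> d u x + length p"
  using assms(2)
proof (induction p arbitrary: x)
  case Nil
  then show ?case by (simp add: T.awalk_Nil_iff)
next
  case (Cons e p)
  then have e: "e \<in> E" "x = fst e" "T.awalk (snd e) p v" by (auto simp: T.awalk_Cons_iff)
  then show ?case
    using Cons.IH[OF e(3)] tree_metric_step_le[OF tm assms(1), of x "snd e"] by auto
qed

lemma tree_metric_graph_dist:
  assumes "u \<in> W" "v \<in> W"
  shows "graph_dist (with_proj (pair_graph_of W E)) u v = ereal (real (d u v))"
proof -
  have cost: "T.awalk_cost (\<lambda>_. 1) p = real (length p)" for p :: "('v \<times> 'v) list"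
    by (induction p) auto
  show ?thesis
    unfolding graph_dist_def T.\<mu>_def
  proof (rule antisym)
    obtain p where p: "T.awalk u p v" "length p = d u v" using tree_metric_walk_ex[OF assms] by blast
    then show "(INF p\<in>{p. T.awalk u p v}. ereal (T.awalk_cost (\<lambda>_. 1) p)) \<le> ereal (real (d u v))"
      using INF_lower2[of p "{p. T.awalk u p v}" "\<lambda>p. ereal (T.awalk_cost (\<lambda>_. 1) p)"] by (simp add: cost)
    show "ereal (real (d u v)) \<le> (INF p\<in>{p. T.awalk u p v}. ereal (T.awalk_cost (\<lambda>_. 1) p))"
    proof (rule INF_greatest)
      fix p assume "p \<in> {p. T.awalk u p v}"
      then show "ereal (real (d u v)) \<le> ereal (T.awalk_cost (\<lambda>_. 1) p)"
        using tree_metric_walk_le[OF assms(1), of u p v] tree_metricD(4)[OF tm assms(1)]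
        by (simp add: cost)
    qed
  qed
qed

text \<open>
  On a cycle starting at \<open>u\<close>, a vertex of maximal distance from \<open>u\<close> is not \<open>u\<close> itself, and neither of
  its two neighbours on the cycle is farther away.  Both are therefore its unique descending
  neighbour, and a closed walk that returns to the previous vertex is a cycle only if it consists
  of a single edge traversed back and forth.
\<close>
lemma tree_metric_no_cycle:
  assumes "T.cycle p"
  shows "length p < 3"
proof (rule ccontr)
  assume "\<not> length p < 3"
  then have len: "3 \<le> length p" by simp
  from assms obtain u where u: "T.awalk u p u" "distinct (tl (T.awalk_verts u p))"
    unfolding T.cycle_def by blast
  define vs where "vs = T.awalk_verts u p"
  have lvs: "length vs = Suc (length p)" unfolding vs_def by (rule T.length_awalk_verts)
  have ne: "vs \<noteq> []" using lvs by auto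
  have step: "(vs ! i, vs ! Suc i) \<in> E" if "i < length p" for i
    using T.awalk_verts_step[OF u(1) that] unfolding vs_def by simp
  have uW: "u \<in> W" using T.awalk_hd_in_verts[OF u(1)] by simp
  have v0: "vs ! 0 = u"
    using T.awhd_of_awalk[OF u(1)] ne by (simp add: vs_def[symmetric] hd_conv_nth)
  have vn: "vs ! length p = u"
    using T.awlast_of_awalk[OF u(1)] ne lvs by (simp add: vs_def[symmetric] last_conv_nth)
  define m where "m = Max ((\<lambda>i. d u (vs ! i)) ` {..length p})"
  have "m \<in> (\<lambda>i. d u (vs ! i)) ` {..length p}" unfolding m_def by (rule Max_in) auto
  then obtain i where i: "i \<le> length p" "d u (vs ! i) = m" by auto
  have max: "d u (vs ! j) \<le> m" if "j \<le> length p" for j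
    unfolding m_def by (rule Max_ge) (use that in auto)
  have "d u (vs ! 1) = 1" using tree_metricD(5)[OF tm, of u "vs ! 1"] step[of 0] len v0 by fastforce
  then have m: "1 \<le> m" using max[of 1] len by simp
  then have "vs ! i \<noteq> u" using i(2) tree_metricD(4)[OF tm uW] by auto
  then obtain j where j: "i = Suc j" "Suc j < length p"
    using v0 vn i(1) by (metis le_neq_implies_less not0_implies_Suc)
  have W: "vs ! i \<in> W" using step[of i] j tree_metricD(2)[OF tm] by auto
  from tree_metric_descend[OF tm uW W] \<open>vs ! i \<noteq> u\<close> obtain w where
    w: "\<And>v. (vs ! i, v) \<in> E \<Longrightarrow> v \<noteq> w \<Longrightarrow> d u v = Suc (d u (vs ! i))" by metis
  have nb: "(vs ! i, vs ! j) \<in> E" "(vs ! i, vs ! Suc i) \<in> E"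
    using step[of j] step[of i] j symD[OF tree_metricD(3)[OF tm]] by auto
  have eqw: "x = w" if "(vs ! i, x) \<in> E" "d u x \<le> m" for x
  proof (rule ccontr)
    assume "x \<noteq> w"
    from w[OF that(1) this] that(2) i(2) show False by simp
  qed
  have "d u (vs ! j) \<le> m" "d u (vs ! Suc i) \<le> m" using j by (auto intro!: max)
  then have "vs ! j = vs ! Suc i" using eqw[OF nb(1)] eqw[OF nb(2)] by simp
  then have eq: "vs ! j = vs ! Suc (Suc j)" unfolding j(1) .
  have tl: "tl vs ! n = vs ! Suc n" if "n < length p" for n
    using that lvs by (simp add: nth_tl)
  have inj: "n = n'" if "n < length p" "n' < length p" "vs ! Suc n = vs ! Suc n'" for n n'
    using nth_eq_iff_index_eq[OF u(2)[folded vs_def], of n n'] that lvs tl by simp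
  \<comment> \<open>Distinctness holds for the vertices without the first one; a position 0 is moved to the end.\<close>
  show False
  proof (cases j)
    case 0
    have "Suc (length p - 1) = length p" using len by simp
    then have "vs ! Suc (length p - 1) = vs ! Suc 1" using eq v0 vn 0 by simp
    then have "length p - 1 = 1" by (rule inj[rotated 2]) (use len in linarith)+
    then show False using len by linarith
  next
    case (Suc j')
    then show False using inj[of j' "Suc j"] eq j by simp
  qed
qed

lemma tree_metric_undirected_tree:
  assumes "W \<noteq> {}"
  shows "undirected_tree (with_proj (pair_graph_of W E))"
  unfolding undirected_tree_def
proof (intro conjI)
  show "Digraph.graph (with_proj (pair_graph_of W E))" by (rule T.pair_graphD_graph)
  have "strongly_connected (with_proj (pair_graph_of W E))"
  proof
    fix u v assume "u \<in> verts (with_proj (pair_graph_of W E))" "v \<in> verts (with_proj (pair_graph_of W E))"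
    then show "u \<rightarrow>\<^sup>*\<^bsub>with_proj (pair_graph_of W E)\<^esub> v"
      using tree_metric_walk_ex[of u v] T.reachable_awalkI by auto
  qed (use assms in simp)
  then show "Digraph_Component.connected (with_proj (pair_graph_of W E))"
    unfolding connected_def strongly_connected_def
    by (simp add: T.reachable_mk_symmetricI)
  show "\<not> (\<exists>p. T.cycle p \<and> 3 \<le> length p)"
  proof
    assume "\<exists>p. T.cycle p \<and> 3 \<le> length p"
    then obtain p where "T.cycle p" "3 \<le> length p" by blast
    with tree_metric_no_cycle[of p] show False by simp
  qed
qed

end

section \<open>Attaching the leaves\<close>

fun leaf_dist :: "('v \<Rightarrow> 'v \<Rightarrow> nat) \<Rightarrow> ('a \<Rightarrow> 'v) \<Rightarrow> 'a + 'v \<Rightarrow> 'a + 'v \<Rightarrow> nat" where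
  "leaf_dist d a (Inl u) (Inl v) = (if u = v then 0 else d (a u) (a v) + 2)"
| "leaf_dist d a (Inl u) (Inr q) = Suc (d (a u) q)"
| "leaf_dist d a (Inr p) (Inl v) = Suc (d p (a v))"
| "leaf_dist d a (Inr p) (Inr q) = d p q"

definition leaf_edges :: "'a set \<Rightarrow> ('v \<times> 'v) set \<Rightarrow> ('a \<Rightarrow> 'v) \<Rightarrow> (('a + 'v) \<times> ('a + 'v)) set" where
  "leaf_edges S E a = {(Inr p, Inr q) |p q. (p, q) \<in> E} \<union> (\<lambda>u. (Inl u, Inr (a u))) ` S \<union> (\<lambda>u. (Inr (a u), Inl u)) ` S"

lemma in_leaf_edges [simp]:
  "(Inl u, Inl v) \<notin> leaf_edges S E a"
  "(Inl u, Inr q) \<in> leaf_edges S E a \<longleftrightarrow> u \<in> S \<and> q = a u"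
  "(Inr p, Inl v) \<in> leaf_edges S E a \<longleftrightarrow> v \<in> S \<and> p = a v"
  "(Inr p, Inr q) \<in> leaf_edges S E a \<longleftrightarrow> (p, q) \<in> E"
  by (auto simp: leaf_edges_def)

lemma leaf_edges_Inl: "(Inl u, y) \<in> leaf_edges S E a \<longleftrightarrow> u \<in> S \<and> y = Inr (a u)"
  by (cases y) auto

lemma tree_metric_attach_leaves:
  assumes tm: "tree_metric W E d" and fin: "finite S" and aW: "a ` S \<subseteq> W"
    and inj: "\<And>u v. u \<in> S \<Longrightarrow> v \<in> S \<Longrightarrow> u \<noteq> v \<Longrightarrow> a u \<noteq> a v"
  shows "tree_metric (Inl ` S \<union> Inr ` W) (leaf_edges S E a) (leaf_dist d a)"
    (is "tree_metric ?W ?E ?d")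
proof (rule tree_metricI)
  note D = tree_metricD[OF tm]
  show "finite ?W" using fin D(1) by simp
  show "?E \<subseteq> ?W \<times> ?W" using D(2) aW by (auto simp: leaf_edges_def)
  show "sym ?E" using D(3) by (auto simp: leaf_edges_def sym_def)
  show "?d u u = 0" if "u \<in> ?W" for u using that D(4) by auto
  show "?d u v = 1" if "(u, v) \<in> ?E" for u v
    using that D(4,5) aW by (cases u; cases v) auto
  have step: "(Inr p, y) \<in> ?E \<Longrightarrow> (\<exists>q. y = Inr q \<and> (p, q) \<in> E) \<or> (\<exists>v\<in>S. y = Inl v \<and> p = a v)" for p y
    by (cases y) auto
  fix u v assume uv: "u \<in> ?W" "v \<in> ?W" "u \<noteq> v"
  let ?goal = "\<exists>v'. (v, v') \<in> ?E \<and> ?d u v = Suc (?d u v') \<and>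
              (\<forall>v''. (v, v'') \<in> ?E \<and> v'' \<noteq> v' \<longrightarrow> ?d u v'' = Suc (?d u v))"
  show ?goal
  proof (cases v)
    case (Inl y)
    then show ?thesis using uv
      by (intro exI[of _ "Inr (a y)"]) (cases u; auto simp: leaf_edges_Inl)
  next
    case (Inr q)
    then have q: "q \<in> W" using uv by auto
    show ?thesis
    proof (cases u)
      case u: (Inl x)
      then have x: "x \<in> S" "a x \<in> W" using uv aW by auto
      show ?thesis
      proof (cases "a x = q")
        case True
        have z: "d q q = 0" using D(4) q by simp
        show ?thesis
        proof (intro exI[of _ "Inl x"] conjI allI impI)
          fix v'' assume "(v, v'') \<in> ?E \<and> v'' \<noteq> Inl x"
          then show "?d u v'' = Suc (?d u v)"
            using step[of q v''] Inr u True z D(5)[of q] inj x by auto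
        qed (use Inr u x True z in auto)
      next
        case False
        from tree_metric_descend[OF tm x(2) q False] obtain q' where
          q': "(q, q') \<in> E" "d (a x) q = Suc (d (a x) q')"
          "\<And>w. (q, w) \<in> E \<Longrightarrow> w \<noteq> q' \<Longrightarrow> d (a x) w = Suc (d (a x) q)" by metis
        show ?thesis
        proof (intro exI[of _ "Inr q'"] conjI allI impI)
          fix v'' assume "(v, v'') \<in> ?E \<and> v'' \<noteq> Inr q'"
          then consider w where "v'' = Inr w" "(q, w) \<in> E" "w \<noteq> q'"
            | w where "v'' = Inl w" "w \<in> S" "q = a w" using step[of q v''] Inr by auto
          then show "?d u v'' = Suc (?d u v)"
            using Inr u False q'(3) by cases auto
        qed (use Inr u x q' in auto)
      qed
    next
      case u: (Inr p)
      then have p: "p \<in> W" "p \<noteq> q" using uv Inr by auto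
      from tree_metric_descend[OF tm p(1) q p(2)] obtain q' where
        q': "(q, q') \<in> E" "d p q = Suc (d p q')"
        "\<And>w. (q, w) \<in> E \<Longrightarrow> w \<noteq> q' \<Longrightarrow> d p w = Suc (d p q)" by metis
      show ?thesis
      proof (intro exI[of _ "Inr q'"] conjI allI impI)
        fix v'' assume "(v, v'') \<in> ?E \<and> v'' \<noteq> Inr q'"
        then consider w where "v'' = Inr w" "(q, w) \<in> E" "w \<noteq> q'"
          | w where "v'' = Inl w" "w \<in> S" "q = a w" using step[of q v''] Inr by auto
        then show "?d u v'' = Suc (?d u v)"
          using Inr u q'(3) by cases auto
      qed (use Inr u q' in auto)
    qed
  qed
qed

lemma exact_leaf_power_if_inner_tree:
  fixes G :: "('a, 'b) pre_digraph"
  assumes T: "has_inner_tree (k - 2) M (\<lambda>u v. u \<rightarrow>\<^bsub>G\<^esub> v) (verts G)"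
    and fin: "finite (verts G)" and ne: "verts G \<noteq> {}" and k: "2 \<le> k" and M: "0 < M"
  shows "exact_leaf_power k G"
proof -
  from T obtain W :: "nat set" and E d a
    where "inner_tree (k - 2) M (\<lambda>u v. u \<rightarrow>\<^bsub>G\<^esub> v) (verts G) W E d a"
    unfolding has_inner_tree_def by blast
  then have tm: "tree_metric W E d" and aW: "a ` verts G \<subseteq> W"
    and deg: "\<And>p. p \<in> W \<Longrightarrow> \<exists>p'. (p, p') \<in> E \<and> (p \<in> a ` verts G \<or> (\<exists>p''. (p, p'') \<in> E \<and> p'' \<noteq> p'))"
    and dist: "\<And>u v. u \<in> verts G \<Longrightarrow> v \<in> verts G \<Longrightarrow> u \<noteq> v \<Longrightarrow>
      M \<le> d (a u) (a v) \<and> (d (a u) (a v) = k - 2 \<longleftrightarrow> u \<rightarrow>\<^bsub>G\<^esub> v)"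
    unfolding inner_tree_def by blast+
  let ?W = "Inl ` verts G \<union> Inr ` W" and ?E = "leaf_edges (verts G) E a"
  let ?T = "with_proj (pair_graph_of ?W ?E)"
  have inj: "a u \<noteq> a v" if "u \<in> verts G" "v \<in> verts G" "u \<noteq> v" for u v
  proof
    assume "a u = a v"
    then have "d (a u) (a v) = 0" using tree_metricD(4)[OF tm] aW that(2) by auto
    then show False using dist[OF that] M by simp
  qed
  have tmT: "tree_metric ?W ?E (leaf_dist d a)"
    using tree_metric_attach_leaves[OF tm fin aW inj] .
  interpret T: pair_graph "pair_graph_of ?W ?E" using tree_metric_pair_graph[OF tmT] .
  have out: "out_arcs ?T v = {e \<in> ?E. fst e = v}" for v by auto
  have finE: "finite ?E" using T.pair_finite_arcs by simp
  have 1: "Inl u \<in> leaves ?T" if "u \<in> verts G" for u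
  proof -
    have "{e \<in> ?E. fst e = Inl u} = {(Inl u, Inr (a u))}" using that by (auto simp: leaf_edges_Inl)
    then show ?thesis using that unfolding leaves_def out_degree_def out by simp
  qed
  have 2: "Inr p \<notin> leaves ?T" if p: "p \<in> W" for p
  proof -
    obtain y z where yz: "(Inr p, y) \<in> ?E" "(Inr p, z) \<in> ?E" "y \<noteq> z"
      using deg[OF p] by (metis (no_types) imageE in_leaf_edges(3,4) sum.inject(2) sum.simps(4))
    have "{(Inr p, y), (Inr p, z)} \<subseteq> {e \<in> ?E. fst e = Inr p}" using yz by auto
    from card_mono[OF _ this] have "2 \<le> out_degree ?T (Inr p)"
      using finE yz(3) unfolding out_degree_def out by simp
    moreover have "verts ?T \<noteq> {Inr p}" using ne by auto
    ultimately show ?thesis unfolding leaves_def by auto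
  qed
  have "leaves ?T \<subseteq> ?W" unfolding leaves_def by auto
  with 1 2 have "leaves ?T = Inl ` verts G" by blast
  moreover have "undirected_tree ?T" using tree_metric_undirected_tree[OF tmT] ne by simp
  moreover have "u \<rightarrow>\<^bsub>G\<^esub> v \<longleftrightarrow> graph_dist ?T (Inl u) (Inl v) = ereal (real k)"
    if "u \<in> verts G" "v \<in> verts G" "u \<noteq> v" for u v
    using that dist[OF that] k by (subst tree_metric_graph_dist[OF tmT]) auto
  ultimately show ?thesis unfolding exact_leaf_power_def by blast
qed

lemma exact_leaf_power_singleton:
  fixes G :: "('a, 'b) pre_digraph"
  assumes "verts G = {v}"
  shows "exact_leaf_power k G"
proof -
  have tm: "tree_metric {Inl v :: 'a + nat} {} (\<lambda>_ _. 0)" by (auto intro!: tree_metricI simp: sym_def)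
  have "undirected_tree (with_proj (pair_graph_of {Inl v :: 'a + nat} {}))"
    using tree_metric_undirected_tree[OF tm] by simp
  then show ?thesis unfolding exact_leaf_power_def
    by (intro exI[of _ "pair_graph_of {Inl v} {}"]) (use assms in \<open>auto simp: leaves_def\<close>)
qed

section \<open>Decomposition at cutvertices\<close>

text \<open>
  Connectedness is expressed for vertex sets and an adjacency relation; \<^const>\<open>rtrancl_on\<close> only
  uses walks inside the set, so this is connectedness of the induced subgraph.
\<close>
definition connected_on :: "('a \<times> 'a) set \<Rightarrow> 'a set \<Rightarrow> bool" where
  "connected_on r S \<longleftrightarrow> (\<forall>x\<in>S. \<forall>y\<in>S. (x, y) \<in> rtrancl_on S r)"

definition nonseparable :: "('a \<times> 'a) set \<Rightarrow> 'a set \<Rightarrow> bool" where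
  "nonseparable r S \<longleftrightarrow> S \<noteq> {} \<and> connected_on r S \<and> (\<forall>v\<in>S. connected_on r (S - {v}))"

lemma connected_on_neighbour:
  assumes "connected_on r S" "x \<in> S" "y \<in> S" "x \<noteq> y"
  obtains z where "z \<in> S" "(x, z) \<in> r"
proof -
  have "(x, y) \<in> rtrancl_on S r" using assms unfolding connected_on_def by blast
  then show thesis
    by (cases rule: converse_rtrancl_on_cases) (use assms(4) that in_rtrancl_on_in_F in metis)+
qed

text \<open>
  A part of a connected graph that is attached to the rest at a single vertex \<open>c\<close> is connected: a
  walk to \<open>c\<close> cannot leave the part before it reaches \<open>c\<close>.
\<close>
lemma connected_on_part:
  assumes conn: "connected_on r V" and sym: "sym r" and c: "c \<in> A" and AV: "A \<subseteq> V"
    and closed: "\<And>x y. x \<in> A - {c} \<Longrightarrow> y \<in> V \<Longrightarrow> (x, y) \<in> r \<Longrightarrow> y \<in> A"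
  shows "connected_on r A"
proof -
  have to_c: "(x, c) \<in> rtrancl_on A r" if "x \<in> A" for x
  proof -
    have "(x, c) \<in> rtrancl_on V r" using conn that c AV unfolding connected_on_def by blast
    then show ?thesis using that
    proof (induction rule: converse_rtrancl_on_induct)
      case base
      then show ?case using c by auto
    next
      case (step x y)
      show ?case
      proof (cases "x = c")
        case True
        then show ?thesis using c by auto
      next
        case False
        then have "y \<in> A" using closed[of x y] step by auto
        then show ?thesis using step converse_rtrancl_on_into_rtrancl_on by metis
      qed
    qed
  qed
  have "(c, x) \<in> rtrancl_on A r" if "x \<in> A" for x
    using to_c[OF that] rtrancl_on_sym[OF sym] by (blast dest: symD)
  then show ?thesis using to_c rtrancl_on_trans unfolding connected_on_def by metis
qed

text \<open>
  A connected graph is built from its connected induced subgraphs without cutvertices by gluing at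
  single vertices: a cutvertex \<open>c\<close> splits the graph into one component of the graph minus \<open>c\<close>, with
  \<open>c\<close> added, and the rest.  Quantifying over all such induced subgraphs instead of the blocks avoids
  relating the blocks of the pieces to those of the whole graph.
\<close>
lemma nonseparable_induct:
  assumes fin: "finite V" and ne: "V \<noteq> {}" and conn: "connected_on r V" and sym: "sym r"
    and base: "\<And>S. S \<subseteq> V \<Longrightarrow> nonseparable r S \<Longrightarrow> P S"
    and glue: "\<And>A B c. A \<inter> B = {c} \<Longrightarrow> A \<noteq> {c} \<Longrightarrow> B \<noteq> {c} \<Longrightarrow>
       (\<And>x y. x \<in> A - {c} \<Longrightarrow> y \<in> B - {c} \<Longrightarrow> (x, y) \<notin> r \<and> (y, x) \<notin> r) \<Longrightarrow>
       P A \<Longrightarrow> P B \<Longrightarrow> P (A \<union> B)"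
  shows "P V"
proof -
  have "P U" if "U \<subseteq> V" "U \<noteq> {}" "connected_on r U" for U
    using that
  proof (induction "card U" arbitrary: U rule: less_induct)
    case less
    note U = less.prems
    have finU: "finite U" using fin U(1) by (rule finite_subset[rotated])
    show ?case
    proof (cases "nonseparable r U")
      case True
      then show ?thesis using base U(1) by blast
    next
      case False
      then obtain c x y where c: "c \<in> U" and xy: "x \<in> U - {c}" "y \<in> U - {c}"
        and sep: "(x, y) \<notin> rtrancl_on (U - {c}) r"
        using U unfolding nonseparable_def connected_on_def by blast
      define A where "A = insert c {z. (x, z) \<in> rtrancl_on (U - {c}) r}"
      define B where "B = U - {z. (x, z) \<in> rtrancl_on (U - {c}) r}"
      have A0: "z \<in> U - {c}" if "(x, z) \<in> rtrancl_on (U - {c}) r" for z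
        using in_rtrancl_on_in_F(2)[OF that] .
      have AB: "A \<inter> B = {c}" "A \<union> B = U" using c A0 by (auto simp: A_def B_def)
      have xA: "x \<in> A" "x \<notin> B" and yB: "y \<in> B" "y \<notin> A"
        using xy sep unfolding A_def B_def by (auto intro: rtrancl_on_refl)
      have step: "(z, w) \<notin> r" if "z \<in> A - {c}" "w \<in> B - {c}" for z w
      proof
        assume "(z, w) \<in> r"
        then have "(x, w) \<in> rtrancl_on (U - {c}) r"
          using that unfolding A_def B_def by (auto intro: rtrancl_on_into_rtrancl_on)
        then show False using that unfolding B_def by blast
      qed
      then have step': "(z, w) \<notin> r \<and> (w, z) \<notin> r" if "z \<in> A - {c}" "w \<in> B - {c}" for z w
        using that sym by (meson symD)
      have connA: "connected_on r A"
        by (rule connected_on_part[OF U(3) sym, of c]) (use AB step in blast)+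
      have connB: "connected_on r B"
        by (rule connected_on_part[OF U(3) sym, of c]) (use AB step' in blast)+
      have "A \<subset> U" "B \<subset> U" using AB(2) xA yB by blast+
      then have "card A < card U" "card B < card U" using finU psubset_card_mono by blast+
      moreover have "A \<subseteq> V" "B \<subseteq> V" "A \<noteq> {}" "B \<noteq> {}" using AB(2) U(1) xA yB by blast+
      ultimately have "P A" "P B" using less.hyps connA connB by blast+
      moreover have "A \<noteq> {c}" "B \<noteq> {c}" using xA yB xy by blast+
      ultimately show ?thesis using glue[OF AB(1) _ _ step'] AB(2) by simp
    qed
  qed
  then show ?thesis using ne conn by blast
qed

section \<open>Two-colourings\<close>

definition two_colourable :: "('a \<times> 'a) set \<Rightarrow> 'a set \<Rightarrow> bool" where
  "two_colourable r S \<longleftrightarrow> (\<exists>f :: 'a \<Rightarrow> bool. \<forall>x\<in>S. \<forall>y\<in>S. (x, y) \<in> r \<longrightarrow> f x \<noteq> f y)"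

text \<open>
  The second colouring is inverted if it disagrees with the first one at the common vertex.
\<close>
lemma two_colourable_glue:
  assumes A: "two_colourable r A" and B: "two_colourable r B" and AB: "A \<inter> B = {c}"
    and nadj: "\<And>x y. x \<in> A - {c} \<Longrightarrow> y \<in> B - {c} \<Longrightarrow> (x, y) \<notin> r \<and> (y, x) \<notin> r"
  shows "two_colourable r (A \<union> B)"
proof -
  from A obtain f :: "'a \<Rightarrow> bool" where f: "\<And>x y. x \<in> A \<Longrightarrow> y \<in> A \<Longrightarrow> (x, y) \<in> r \<Longrightarrow> f x \<noteq> f y"
    unfolding two_colourable_def by blast
  from B obtain g :: "'a \<Rightarrow> bool" where g: "\<And>x y. x \<in> B \<Longrightarrow> y \<in> B \<Longrightarrow> (x, y) \<in> r \<Longrightarrow> g x \<noteq> g y"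
    unfolding two_colourable_def by blast
  define h where "h x = (if x \<in> A then f x else if f c = g c then g x else \<not> g x)" for x
  have hB: "h x = (if f c = g c then g x else \<not> g x)" if "x \<in> B" for x
  proof -
    have "x \<in> A \<Longrightarrow> x = c" using that AB by blast
    then show ?thesis unfolding h_def by auto
  qed
  have hA: "h x = f x" if "x \<in> A" for x using that by (simp add: h_def)
  have "h x \<noteq> h y" if xy: "x \<in> A \<union> B" "y \<in> A \<union> B" "(x, y) \<in> r" for x y
  proof -
    have "x \<in> A \<and> y \<in> A \<or> x \<in> B \<and> y \<in> B" using xy nadj[of x y] nadj[of y x] AB by blast
    then show ?thesis
    proof
      assume "x \<in> A \<and> y \<in> A"
      then show ?thesis using f[of x y] hA xy(3) by simp
    next
      assume "x \<in> B \<and> y \<in> B"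
      then show ?thesis using g[of x y] hB[of x] hB[of y] xy(3) by (auto split: if_splits)
    qed
  qed
  then show ?thesis unfolding two_colourable_def by blast
qed

section \<open>Induced subgraphs without cutvertices lie in blocks\<close>

lemma rtrancl_on_restrict: "rtrancl_on S (r \<inter> S \<times> S) = rtrancl_on S r"
proof -
  have "(x, y) \<in> rtrancl_on S (r \<inter> S \<times> S)" if "(x, y) \<in> rtrancl_on S r" for x y
    using that
    by (induction rule: rtrancl_on_induct) (auto intro: rtrancl_on_into_rtrancl_on rtrancl_on_refl)
  moreover have "(x, y) \<in> rtrancl_on S r" if "(x, y) \<in> rtrancl_on S (r \<inter> S \<times> S)" for x y
    using rtrancl_on_mono[OF _ _ that] by blast
  ultimately show ?thesis by auto
qed

lemma arcs_ends_induce_subgraph: "arcs_ends (G \<restriction> S) = arcs_ends G \<inter> S \<times> S"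
  by (auto simp: arcs_ends_conv)

lemma reachable_induce_subgraph: "x \<rightarrow>\<^sup>*\<^bsub>G \<restriction> S\<^esub> y \<longleftrightarrow> (x, y) \<in> rtrancl_on S (arcs_ends G)"
  unfolding reachable_def arcs_ends_induce_subgraph by (simp add: rtrancl_on_restrict)

lemma arcs_ends_del_vert:
  "arcs_ends (pre_digraph.del_vert G v) = arcs_ends G \<inter> (- {v}) \<times> (- {v})"
  by (auto simp: arcs_ends_conv pre_digraph.del_vert_simps)

lemma (in wf_digraph) reachable_del_vert:
  "x \<rightarrow>\<^sup>*\<^bsub>del_vert v\<^esub> y \<longleftrightarrow> (x, y) \<in> rtrancl_on (verts G - {v}) (arcs_ends G)"
proof -
  have "arcs_ends G \<inter> (- {v}) \<times> (- {v}) = arcs_ends G \<inter> (verts G - {v}) \<times> (verts G - {v})"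
    using adj_in_verts by auto
  then show ?thesis
    unfolding reachable_def arcs_ends_del_vert using rtrancl_on_restrict
    by (metis verts_del_vert)
qed

lemma graph_connected_iff:
  assumes "Digraph.graph G"
  shows "Digraph_Component.connected G \<longleftrightarrow> verts G \<noteq> {} \<and> connected_on (arcs_ends G) (verts G)"
proof -
  interpret graph G by fact
  show ?thesis
    unfolding connected_def strongly_connected_def connected_on_def
    using reachable_mk_symmetric_eq[OF sym_arcs] by (simp add: reachable_def)
qed

lemma graph_sym: "Digraph.graph G \<Longrightarrow> sym (arcs_ends G)"
  by (simp add: Digraph.graph_def pseudo_graph_def sym_digraph_def sym_digraph_axioms_def symmetric_def)

lemma graph_irrefl: "Digraph.graph G \<Longrightarrow> (x, x) \<notin> arcs_ends G"
  using loopfree_digraph.adj_not_same[of G x] by (auto simp: Digraph.graph_def digraph_def)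

lemma nonseparable_induce_subgraph:
  assumes G: "Digraph.graph G" and S: "S \<subseteq> verts G" "nonseparable (arcs_ends G) S"
  shows "Digraph.graph (G \<restriction> S)" "Digraph_Component.connected (G \<restriction> S)"
    "\<not> cutvertex (G \<restriction> S) v"
proof -
  interpret G: graph G by fact
  have sub: "induced_subgraph (G \<restriction> S) G" using S(1) by (rule G.induced_induce)
  show gS: "Digraph.graph (G \<restriction> S)"
    using G.digraph_subgraph[OF induced_imp_subgraph[OF sub]] G.induced_graph_imp_graph[OF sub]
    by (simp add: digraph.graphI sym_digraph.sym_arcs)
  interpret S: graph "G \<restriction> S" by fact
  have restr: "rtrancl_on T (arcs_ends (G \<restriction> S)) = rtrancl_on T (arcs_ends G)" if "T \<subseteq> S" for T
  proof -
    have "arcs_ends (G \<restriction> S) \<inter> T \<times> T = arcs_ends G \<inter> T \<times> T"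
      using that unfolding arcs_ends_induce_subgraph by auto
    then show ?thesis by (metis rtrancl_on_restrict)
  qed
  show "Digraph_Component.connected (G \<restriction> S)"
    using S(2) restr[of S] by (simp add: graph_connected_iff[OF gS] nonseparable_def connected_on_def)
  show "\<not> cutvertex (G \<restriction> S) v"
    using S(2) restr[of "S - {v}"] unfolding cutvertex_def S.reachable_del_vert
    by (auto simp: nonseparable_def connected_on_def)
qed

text \<open>
  Among the connected subgraphs without cutvertices that contain the given induced subgraph, one with
  the largest number of vertices and arcs is a block.
\<close>
lemma nonseparable_in_block:
  assumes G: "Digraph.graph G" and S: "S \<subseteq> verts G" "nonseparable (arcs_ends G) S"
  obtains H where "block H G" "S \<subseteq> verts H"
    "\<And>u v. u \<in> S \<Longrightarrow> v \<in> S \<Longrightarrow> (u, v) \<in> arcs_ends H \<longleftrightarrow> (u, v) \<in> arcs_ends G"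
proof -
  interpret G: graph G by fact
  define Q where "Q H \<longleftrightarrow> subgraph (G \<restriction> S) H \<and> subgraph H G \<and>
      Digraph.graph H \<and> Digraph_Component.connected H \<and> (\<forall>v. \<not> cutvertex H v)" for H
  define m where "m H = card (verts H) + card (arcs H)" for H :: "('a, 'b) pre_digraph"
  have "subgraph (G \<restriction> S) G" using S(1) induced_imp_subgraph by blast
  moreover have "subgraph (G \<restriction> S) (G \<restriction> S)"
    using wf_digraph.subgraph_refl G.wellformed_induce_subgraph by blast
  ultimately have Q0: "Q (G \<restriction> S)" unfolding Q_def using nonseparable_induce_subgraph[OF assms] by blast
  have bound: "m H < Suc (m G)" if "Q H" for H
  proof -
    have "verts H \<subseteq> verts G" "arcs H \<subseteq> arcs G" using that unfolding Q_def by auto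
    then show ?thesis unfolding m_def by (simp add: add_mono card_mono less_Suc_eq_le)
  qed
  obtain H where H: "Q H" "\<And>H'. Q H' \<Longrightarrow> m H' \<le> m H"
    using ex_has_greatest_nat[of Q, OF Q0, of m "Suc (m G)"] bound by (metis less_imp_le)
  have "\<not> (subgraph H' G \<and> Digraph.graph H' \<and> Digraph_Component.connected H' \<and> (\<forall>v. \<not> cutvertex H' v))"
    if H': "H' \<noteq> H" "subgraph H H'" for H'
  proof
    assume *: "subgraph H' G \<and> Digraph.graph H' \<and> Digraph_Component.connected H' \<and> (\<forall>v. \<not> cutvertex H' v)"
    then have "Q H'" using H(1) H'(2) unfolding Q_def by (blast intro: subgraph_trans)
    then have le: "m H' \<le> m H" by (rule H(2))
    interpret H': graph H' using * by blast
    have sub: "verts H \<subseteq> verts H'" "arcs H \<subseteq> arcs H'" using H'(2) by auto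
    then have "card (verts H) \<le> card (verts H')" "card (arcs H) \<le> card (arcs H')"
      by (simp_all add: card_mono)
    then have "card (verts H) = card (verts H')" "card (arcs H) = card (arcs H')"
      using le unfolding m_def by linarith+
    then have "verts H = verts H'" "arcs H = arcs H'"
      using sub by (simp_all add: card_subset_eq)
    moreover have "tail H = tail H'" "head H = head H'"
      using H'(2) by (auto simp: subgraph_def compatible_def)
    ultimately have "H = H'" by simp
    then show False using H'(1) by simp
  qed
  then have "block H G" using H(1) unfolding block_def pre_digraph.max_subgraph_def Q_def by blast
  moreover have "S \<subseteq> verts H" using H(1) subgraph_imp_subverts[of "G \<restriction> S" H] by (simp add: Q_def)
  moreover have "(u, v) \<in> arcs_ends H \<longleftrightarrow> (u, v) \<in> arcs_ends G" if "u \<in> S" "v \<in> S" for u v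
  proof -
    have "arcs_ends (G \<restriction> S) \<subseteq> arcs_ends H" "arcs_ends H \<subseteq> arcs_ends G"
      using H(1) arcs_ends_mono unfolding Q_def by blast+
    then show ?thesis using that unfolding arcs_ends_induce_subgraph by blast
  qed
  ultimately show thesis using that by blast
qed

lemma bipartite_iff_two_colourable:
  assumes "Digraph.graph G"
  shows "bipartite G \<longleftrightarrow> two_colourable (arcs_ends G) (verts G)"
proof
  assume "bipartite G"
  then obtain U W where UW: "verts G = U \<union> W" "U \<inter> W = {}" "arcs_ends G \<subseteq> U \<times> W \<union> W \<times> U"
    unfolding bipartite_def by blast
  then have "(x \<in> U) \<noteq> (y \<in> U)" if "(x, y) \<in> arcs_ends G" for x y using that by blast
  then show "two_colourable (arcs_ends G) (verts G)"
    unfolding two_colourable_def by (intro exI[of _ "\<lambda>x. x \<in> U"]) blast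
next
  interpret graph G by fact
  assume "two_colourable (arcs_ends G) (verts G)"
  then obtain f :: "_ \<Rightarrow> bool" where
    f: "\<And>x y. x \<in> verts G \<Longrightarrow> y \<in> verts G \<Longrightarrow> (x, y) \<in> arcs_ends G \<Longrightarrow> f x \<noteq> f y"
    unfolding two_colourable_def by blast
  have "(x, y) \<in> {v \<in> verts G. f v} \<times> {v \<in> verts G. \<not> f v} \<union> {v \<in> verts G. \<not> f v} \<times> {v \<in> verts G. f v}"
    if "(x, y) \<in> arcs_ends G" for x y
    using that f[of x y] adj_in_verts[OF that] by auto
  then have "arcs_ends G \<subseteq> {v \<in> verts G. f v} \<times> {v \<in> verts G. \<not> f v} \<union>
      {v \<in> verts G. \<not> f v} \<times> {v \<in> verts G. f v}"
    by (rule subrelI)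
  moreover have "verts G = {v \<in> verts G. f v} \<union> {v \<in> verts G. \<not> f v}"
    "{v \<in> verts G. f v} \<inter> {v \<in> verts G. \<not> f v} = {}" by blast+
  ultimately show "bipartite G"
    unfolding bipartite_def by (intro exI conjI)
qed

section \<open>Exact leaf powers with odd exponent are bipartite\<close>

text \<open>
  A vertex set without cutvertices in a tree has at most two elements.  Otherwise \<open>a\<close> has two
  neighbours \<open>y\<close> and \<open>z\<close> in the set, because removing \<open>y\<close> does not isolate \<open>a\<close>; and a path from \<open>y\<close>
  to \<open>z\<close> avoiding \<open>a\<close> closes to a cycle through \<open>a\<close>.
\<close>
lemma undirected_tree_nonseparable_le_2:
  assumes T: "undirected_tree T" and S: "S \<subseteq> verts T" "nonseparable (arcs_ends T) S"
    and abc: "a \<in> S" "b \<in> S" "c \<in> S" "a \<noteq> b" "a \<noteq> c" "b \<noteq> c"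
  shows False
proof -
  have gT: "Digraph.graph T" using T unfolding undirected_tree_def by blast
  interpret T: graph T by fact
  have conn: "connected_on (arcs_ends T) S" and conn': "\<And>v. v \<in> S \<Longrightarrow> connected_on (arcs_ends T) (S - {v})"
    using S(2) unfolding nonseparable_def by blast+
  obtain y where y: "y \<in> S" "(a, y) \<in> arcs_ends T" "y \<noteq> a"
    using connected_on_neighbour[OF conn abc(1,2,4)] graph_irrefl[OF gT] by metis
  obtain w where "w \<in> S - {y}" "w \<noteq> a" using abc by blast
  then obtain z where z: "z \<in> S" "z \<noteq> y" "(a, z) \<in> arcs_ends T" "z \<noteq> a"
    using connected_on_neighbour[OF conn'[OF y(1)], of a w] y abc(1) graph_irrefl[OF gT]
    by (metis Diff_iff singletonD singletonI)
  interpret R: wf_digraph "T \<restriction> (S - {a})" by (rule T.wellformed_induce_subgraph)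
  have "(y, z) \<in> rtrancl_on (S - {a}) (arcs_ends T)"
    using conn'[OF abc(1)] y z unfolding connected_on_def by blast
  then have "y \<rightarrow>\<^sup>*\<^bsub>T \<restriction> (S - {a})\<^esub> z" by (simp add: reachable_induce_subgraph)
  then obtain p where p: "R.apath y p z" using R.reachable_apath by blast
  have sub: "subgraph (T \<restriction> (S - {a})) T"
    using S(1) T.induced_induce[of "S - {a}"] induced_imp_subgraph by blast
  have pT: "T.apath y p z" using T.subgraph_apath_imp_apath[OF p sub] .
  have "R.awalk y p z" using p by (rule R.awalkI_apath)
  then have "set (R.awalk_verts y p) \<subseteq> S - {a}"
    using R.awalk_verts_in_verts[of y p] by (auto simp: R.awalk_def)
  then have a: "a \<notin> set (T.awalk_verts y p)"
    using compatible_awalk_verts[OF compatible_induce_subgraph[of T "S - {a}"]] by auto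
  obtain e1 where e1: "e1 \<in> arcs T" "tail T e1 = a" "head T e1 = y" using y(2) by auto
  have "(z, a) \<in> arcs_ends T" using z(3) graph_sym[OF gT] by (meson symD)
  then obtain e2 where e2: "e2 \<in> arcs T" "tail T e2 = z" "head T e2 = a" by auto
  have walk: "T.awalk y p z" "distinct (T.awalk_verts y p)" using pT unfolding T.apath_def by auto
  have walk2: "T.awalk z [e2] a" using e2 T.arc_implies_awalk[OF e2(1)] by simp
  have app: "T.awalk y (p @ [e2]) a" using T.awalk_appendI[OF walk(1) walk2] .
  have "T.awalk_verts y (p @ [e2]) = T.awalk_verts y p @ [a]"
    using T.awalk_verts_append[OF app] T.awlast_of_awalk[OF walk(1)] e2 by simp
  then have "distinct (tl (T.awalk_verts a (e1 # p @ [e2])))" using a walk(2) e1 by simp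
  moreover have "T.awalk a (e1 # p @ [e2]) a" using app e1 by (auto simp: T.awalk_Cons_iff)
  ultimately have cyc: "T.cycle (e1 # p @ [e2])" unfolding T.cycle_def by blast
  have "p \<noteq> []" using walk(1) z(2) by (auto simp: T.awalk_Nil_iff)
  then have "3 \<le> length (e1 # p @ [e2])" by (cases p) auto
  with cyc T show False unfolding undirected_tree_def by blast
qed

lemma undirected_tree_two_colourable:
  assumes T: "undirected_tree T"
  shows "two_colourable (arcs_ends T) (verts T)"
proof -
  have gT: "Digraph.graph T" and "Digraph_Component.connected T"
    using T unfolding undirected_tree_def by blast+
  then have conn: "verts T \<noteq> {}" "connected_on (arcs_ends T) (verts T)"
    using graph_connected_iff by blast+
  have fin: "finite (verts T)" using gT by (simp add: Digraph.graph_def digraph_def fin_digraph.finite_verts)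
  show ?thesis
  proof (rule nonseparable_induct[OF fin conn graph_sym[OF gT], of "two_colourable (arcs_ends T)"])
    fix S assume S: "S \<subseteq> verts T" "nonseparable (arcs_ends T) S"
    then obtain s where s: "s \<in> S" unfolding nonseparable_def by blast
    have "(x = s) \<noteq> (y = s)" if "x \<in> S" "y \<in> S" "(x, y) \<in> arcs_ends T" for x y
    proof -
      have "x \<noteq> y" using that graph_irrefl[OF gT] by blast
      moreover have "x = s \<or> y = s \<or> x = y"
        using undirected_tree_nonseparable_le_2[OF T S s that(1,2)] by metis
      ultimately show ?thesis by auto
    qed
    then show "two_colourable (arcs_ends T) S"
      unfolding two_colourable_def by (intro exI[of _ "\<lambda>x. x = s"]) simp
  qed (rule two_colourable_glue)
qed

lemma (in wf_digraph) awalk_parity: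
  assumes f: "\<And>x y. (x, y) \<in> arcs_ends G \<Longrightarrow> f x \<noteq> (f y :: bool)" and p: "awalk u p v"
  shows "f u = f v \<longleftrightarrow> even (length p)"
  using p
proof (induction p arbitrary: u)
  case Nil
  then show ?case by (simp add: awalk_Nil_iff)
next
  case (Cons e p)
  then have e: "e \<in> arcs G" "u = tail G e" "awalk (head G e) p v" by (auto simp: awalk_Cons_iff)
  have "(u, head G e) \<in> arcs_ends G" using e by (auto simp: arcs_ends_conv)
  from f[OF this] show ?case using Cons.IH[OF e(3)] by auto
qed

text \<open>
  If \<open>u\<close> and \<open>v\<close> are adjacent, a shortest path between the corresponding leaves has odd length \<open>k\<close>,
  so the leaves have different colours in a two-colouring of the tree.
\<close>
lemma odd_exact_leaf_power_bipartite:
  fixes G :: "('a, 'b) pre_digraph"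
  assumes G: "Digraph.graph G" and k: "odd k" and ex: "exact_leaf_power k G"
  shows "bipartite G"
proof -
  interpret G: graph G by fact
  from ex obtain T :: "('a + nat) pair_pre_digraph" where
    T: "undirected_tree (with_proj T)" "leaves (with_proj T) = Inl ` verts G"
    and adj: "\<And>u v. u \<in> verts G \<Longrightarrow> v \<in> verts G \<Longrightarrow> u \<noteq> v \<Longrightarrow>
      u \<rightarrow>\<^bsub>G\<^esub> v \<longleftrightarrow> graph_dist (with_proj T) (Inl u) (Inl v) = ereal (real k)"
    unfolding exact_leaf_power_def by blast
  interpret T: graph "with_proj T" using T(1) unfolding undirected_tree_def by blast
  obtain f :: "_ \<Rightarrow> bool" where "\<forall>x\<in>verts (with_proj T). \<forall>y\<in>verts (with_proj T).
      (x, y) \<in> arcs_ends (with_proj T) \<longrightarrow> f x \<noteq> f y"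
    using undirected_tree_two_colourable[OF T(1)] unfolding two_colourable_def by blast
  then have f: "f x \<noteq> f y" if "(x, y) \<in> arcs_ends (with_proj T)" for x y
    using T.adj_in_verts[OF that] that by blast
  have "f (Inl u) \<noteq> f (Inl v)" if uv: "(u, v) \<in> arcs_ends G" for u v
  proof -
    have "u \<in> verts G" "v \<in> verts G" "u \<noteq> v"
      using G.adj_in_verts[OF uv] uv graph_irrefl[OF G] by blast+
    then have \<mu>: "T.\<mu> (\<lambda>_. 1) (Inl u) (Inl v) = ereal (real k)"
      using adj uv unfolding graph_dist_def by blast
    then have "Inl u \<rightarrow>\<^sup>*\<^bsub>with_proj T\<^esub> Inl v" using T.shortest_path_inf by force
    from T.min_cost_awalk[OF this, of "\<lambda>_. 1"] obtain p where
      p: "T.apath (Inl u) p (Inl v)" "T.\<mu> (\<lambda>_. 1) (Inl u) (Inl v) = T.awalk_cost (\<lambda>_. 1) p" by auto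
    have "T.awalk_cost (\<lambda>_. 1) p = real (length p)" by (induction p) auto
    then have "length p = k" using p(2) \<mu> by simp
    then show ?thesis using T.awalk_parity[where f = f, OF f T.awalkI_apath[OF p(1)]] k by blast
  qed
  then have "two_colourable (arcs_ends G) (verts G)"
    unfolding two_colourable_def by (intro exI[of _ "\<lambda>v. f (Inl v)"]) simp
  then show ?thesis using bipartite_iff_two_colourable[OF G] by blast
qed

section \<open>Complete multipartite and complete bipartite blocks\<close>

lemma complete_multipartite_nonadj_trans:
  assumes H: "complete_multipartite H" and xyz: "x \<in> verts H" "y \<in> verts H" "z \<in> verts H"
    and n: "(x, y) \<notin> arcs_ends H" "(y, z) \<notin> arcs_ends H"
  shows "(x, z) \<notin> arcs_ends H"
proof -
  from H obtain P where P: "partition_on (verts H) P"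
    "\<And>u v. u \<in> verts H \<Longrightarrow> v \<in> verts H \<Longrightarrow> (u, v) \<in> arcs_ends H \<longleftrightarrow> \<not> (\<exists>A\<in>P. u \<in> A \<and> v \<in> A)"
    unfolding complete_multipartite_def by blast
  from n obtain A B where AB: "A \<in> P" "x \<in> A" "y \<in> A" "B \<in> P" "y \<in> B" "z \<in> B"
    using P(2)[OF xyz(1,2)] P(2)[OF xyz(2,3)] by auto
  then have "A = B" using partition_onD2[OF P(1)] unfolding disjoint_def by blast
  then have "\<exists>A\<in>P. x \<in> A \<and> z \<in> A" using AB by blast
  then show ?thesis using P(2)[OF xyz(1,3)] by simp
qed

text \<open>
  In a connected graph whose non-adjacency is transitive, a proper two-colouring determines the
  edges.  Suppose that \<open>x\<close> and \<open>y\<close> have different colours and are not adjacent.  Then \<open>y\<close> is not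
  adjacent to any vertex of its own colour, so by transitivity neither is \<open>x\<close>; but \<open>x\<close> has a
  neighbour, which has the colour of \<open>y\<close>.
\<close>
lemma complete_bipartite_colouring:
  assumes conn: "connected_on r S"
    and trans: "\<And>x y z. x \<in> S \<Longrightarrow> y \<in> S \<Longrightarrow> z \<in> S \<Longrightarrow> (x, y) \<notin> r \<Longrightarrow> (y, z) \<notin> r \<Longrightarrow> (x, z) \<notin> r"
    and f: "\<And>x y. x \<in> S \<Longrightarrow> y \<in> S \<Longrightarrow> (x, y) \<in> r \<Longrightarrow> f x \<noteq> (f y :: bool)"
    and xy: "x \<in> S" "y \<in> S"
  shows "(x, y) \<in> r \<longleftrightarrow> f x \<noteq> f y"
proof
  assume ne: "f x \<noteq> f y"
  then obtain z where z: "z \<in> S" "(x, z) \<in> r" using connected_on_neighbour[OF conn xy] by metis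
  then have "f z = f y" using f[OF xy(1) z] ne by blast
  then have "(y, z) \<notin> r" using f[OF xy(2) z(1)] by blast
  show "(x, y) \<in> r"
  proof (rule ccontr)
    assume "(x, y) \<notin> r"
    from trans[OF xy z(1) this \<open>(y, z) \<notin> r\<close>] z(2) show False by blast
  qed
qed (rule f[OF xy])

lemma complete_bipartite_if_bipartite:
  assumes H: "complete_multipartite H" "Digraph_Component.connected H" and bip: "bipartite H"
  shows "complete_bipartite H"
proof -
  have gH: "Digraph.graph H" using H(1) unfolding complete_multipartite_def by blast
  interpret graph H by fact
  obtain f :: "_ \<Rightarrow> bool" where
    f: "\<And>x y. x \<in> verts H \<Longrightarrow> y \<in> verts H \<Longrightarrow> (x, y) \<in> arcs_ends H \<Longrightarrow> f x \<noteq> f y"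
    using bip bipartite_iff_two_colourable[OF gH] unfolding two_colourable_def by blast
  have conn: "connected_on (arcs_ends H) (verts H)" using H(2) graph_connected_iff[OF gH] by blast
  have eq: "(x, y) \<in> arcs_ends H \<longleftrightarrow> f x \<noteq> f y" if "x \<in> verts H" "y \<in> verts H" for x y
    using complete_bipartite_colouring[where f = f,
        OF conn complete_multipartite_nonadj_trans[OF H(1)] f that] .
  let ?U = "{v \<in> verts H. f v}" and ?V = "{v \<in> verts H. \<not> f v}"
  have mem: "(x, y) \<in> arcs_ends H \<longleftrightarrow> (x, y) \<in> ?U \<times> ?V \<union> ?V \<times> ?U" for x y
    using eq[of x y] adj_in_verts[of x y] by auto
  have "arcs_ends H = ?U \<times> ?V \<union> ?V \<times> ?U"
    by (intro equalityI subrelI) (erule iffD1[OF mem], erule iffD2[OF mem])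
  moreover have "verts H = ?U \<union> ?V" "?U \<inter> ?V = {}" by auto
  ultimately have "complete_bipartite_digraph (card ?U) (card ?V) H"
    unfolding complete_bipartite_digraph_def using gH by blast
  then show ?thesis unfolding complete_bipartite_def by blast
qed

section \<open>Characterisation of the exact leaf powers\<close>

context
  fixes G :: "('a, 'b) pre_digraph"
  assumes G: "Digraph.graph G" "Digraph_Component.connected G"
begin

interpretation graph G by (rule G)

lemmas block_induct =
  nonseparable_induct[OF finite_verts conjunct1[OF G(2)[unfolded graph_connected_iff[OF G(1)]]]
    conjunct2[OF G(2)[unfolded graph_connected_iff[OF G(1)]]] graph_sym[OF G(1)]]

lemma bipartite_iff_blocks_complete_bipartite:
  assumes "\<forall>H. block H G \<longrightarrow> complete_multipartite H"
  shows "bipartite G \<longleftrightarrow> (\<forall>H. block H G \<longrightarrow> complete_bipartite H)"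
proof (intro iffI allI impI)
  fix H assume bip: "bipartite G" and H: "block H G"
  then have sub: "subgraph H G" and conn: "Digraph_Component.connected H" and gH: "Digraph.graph H"
    unfolding block_def pre_digraph.max_subgraph_def by blast+
  obtain f :: "_ \<Rightarrow> bool" where
    f: "\<forall>x\<in>verts G. \<forall>y\<in>verts G. (x, y) \<in> arcs_ends G \<longrightarrow> f x \<noteq> f y"
    using bip unfolding bipartite_iff_two_colourable[OF G(1)] two_colourable_def by blast
  have "\<forall>x\<in>verts H. \<forall>y\<in>verts H. (x, y) \<in> arcs_ends H \<longrightarrow> f x \<noteq> f y"
    using f arcs_ends_mono[OF sub] subgraph_imp_subverts[OF sub] by blast
  then have "bipartite H"
    unfolding bipartite_iff_two_colourable[OF gH] two_colourable_def by blast
  moreover have "complete_multipartite H" using assms H by blast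
  ultimately show "complete_bipartite H" using complete_bipartite_if_bipartite[OF _ conn] by simp
next
  assume blocks: "\<forall>H. block H G \<longrightarrow> complete_bipartite H"
  have "two_colourable (arcs_ends G) (verts G)"
  proof (rule block_induct)
    fix S assume S: "S \<subseteq> verts G" "nonseparable (arcs_ends G) S"
    obtain H where H: "block H G" "S \<subseteq> verts H"
      "\<And>u v. u \<in> S \<Longrightarrow> v \<in> S \<Longrightarrow> (u, v) \<in> arcs_ends H \<longleftrightarrow> (u, v) \<in> arcs_ends G"
      using nonseparable_in_block[OF G(1) S] by blast
    have "complete_bipartite H" using blocks H(1) by blast
    then obtain U V where "verts H = U \<union> V" "U \<inter> V = {}" "arcs_ends H = U \<times> V \<union> V \<times> U"
      unfolding complete_bipartite_def complete_bipartite_digraph_def by blast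
    then have "(x \<in> U) \<noteq> (y \<in> U)" if "x \<in> S" "y \<in> S" "(x, y) \<in> arcs_ends G" for x y
      using that H(3)[of x y] by blast
    then show "two_colourable (arcs_ends G) S"
      unfolding two_colourable_def by (intro exI[of _ "\<lambda>x. x \<in> U"]) blast
  qed (rule two_colourable_glue)
  then show "bipartite G" using bipartite_iff_two_colourable[OF G(1)] by blast
qed

text \<open>
  A single vertex has no inner tree: a tree in which it is a leaf has a second leaf.  The
  induction therefore only claims an inner tree for sets with at least two vertices; both parts of
  a decomposition at a cutvertex have this property.
\<close>
lemma exact_leaf_power_if_blocks:
  assumes far: "k - 2 < 2 * M" and k: "2 \<le> k"
    and base: "\<And>S x y. S \<subseteq> verts G \<Longrightarrow> nonseparable (arcs_ends G) S \<Longrightarrow> x \<in> S \<Longrightarrow> y \<in> S \<Longrightarrow> x \<noteq> y \<Longrightarrow>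
      has_inner_tree (k - 2) M (\<lambda>u v. u \<rightarrow>\<^bsub>G\<^esub> v) S"
  shows "exact_leaf_power k G"
proof (cases "\<exists>x\<in>verts G. \<exists>y\<in>verts G. x \<noteq> y")
  case True
  have "(\<exists>x\<in>verts G. \<exists>y\<in>verts G. x \<noteq> y) \<longrightarrow> has_inner_tree (k - 2) M (\<lambda>u v. u \<rightarrow>\<^bsub>G\<^esub> v) (verts G)"
  proof (rule block_induct)
    fix A B c
    assume AB: "A \<inter> B = {c}" "A \<noteq> {c}" "B \<noteq> {c}"
      and nadj: "\<And>x y. x \<in> A - {c} \<Longrightarrow> y \<in> B - {c} \<Longrightarrow> \<not> x \<rightarrow>\<^bsub>G\<^esub> y \<and> \<not> y \<rightarrow>\<^bsub>G\<^esub> x"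
      and IH: "(\<exists>x\<in>A. \<exists>y\<in>A. x \<noteq> y) \<longrightarrow> has_inner_tree (k - 2) M (\<lambda>u v. u \<rightarrow>\<^bsub>G\<^esub> v) A"
        "(\<exists>x\<in>B. \<exists>y\<in>B. x \<noteq> y) \<longrightarrow> has_inner_tree (k - 2) M (\<lambda>u v. u \<rightarrow>\<^bsub>G\<^esub> v) B"
    have "\<exists>x\<in>A. \<exists>y\<in>A. x \<noteq> y" "\<exists>x\<in>B. \<exists>y\<in>B. x \<noteq> y" using AB by blast+
    then have "has_inner_tree (k - 2) M (\<lambda>u v. u \<rightarrow>\<^bsub>G\<^esub> v) A" "has_inner_tree (k - 2) M (\<lambda>u v. u \<rightarrow>\<^bsub>G\<^esub> v) B"
      using IH by simp_all
    then have "has_inner_tree (k - 2) M (\<lambda>u v. u \<rightarrow>\<^bsub>G\<^esub> v) (A \<union> B)"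
      by (rule has_inner_tree_glue[OF _ _ AB(1) far nadj])
    then show "(\<exists>x\<in>A \<union> B. \<exists>y\<in>A \<union> B. x \<noteq> y) \<longrightarrow> has_inner_tree (k - 2) M (\<lambda>u v. u \<rightarrow>\<^bsub>G\<^esub> v) (A \<union> B)"
      by simp
  qed (use base in blast)
  then show ?thesis
    using exact_leaf_power_if_inner_tree[of k M G] True far k by auto
next
  case False
  moreover have "verts G \<noteq> {}" using G graph_connected_iff by blast
  ultimately obtain v where "verts G = {v}" by blast
  then show ?thesis by (rule exact_leaf_power_singleton)
qed

context
  assumes blocks: "\<forall>H. block H G \<longrightarrow> complete_multipartite H"
begin

text \<open>
  Non-adjacency is transitive in a complete multipartite graph, and this is inherited by the induced
  subgraphs of a block.
\<close>
lemma nonseparable_nonadj_trans: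
  assumes S: "S \<subseteq> verts G" "nonseparable (arcs_ends G) S" and xyz: "x \<in> S" "y \<in> S" "z \<in> S"
    and n: "(x, y) \<notin> arcs_ends G" "(y, z) \<notin> arcs_ends G"
  shows "(x, z) \<notin> arcs_ends G"
proof -
  obtain H where H: "block H G" "S \<subseteq> verts H"
      "\<And>u v. u \<in> S \<Longrightarrow> v \<in> S \<Longrightarrow> (u, v) \<in> arcs_ends H \<longleftrightarrow> (u, v) \<in> arcs_ends G"
    using nonseparable_in_block[OF G(1) S] by blast
  have "(x, y) \<notin> arcs_ends H" "(y, z) \<notin> arcs_ends H" using H(3) xyz n by simp_all
  then have "(x, z) \<notin> arcs_ends H"
    using complete_multipartite_nonadj_trans[of H x y z] blocks H(1,2) xyz by blast
  then show ?thesis using H(3) xyz by simp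
qed

lemma odd_exact_leaf_power:
  assumes "bipartite G" "odd k" "5 \<le> k"
  shows "exact_leaf_power k G"
proof (rule exact_leaf_power_if_blocks[where M = "k - 3"])
  fix S x y assume S: "S \<subseteq> verts G" "nonseparable (arcs_ends G) S" and xy: "x \<in> S" "y \<in> S" "x \<noteq> y"
  obtain f :: "_ \<Rightarrow> bool" where
    f: "\<And>x y. x \<in> verts G \<Longrightarrow> y \<in> verts G \<Longrightarrow> (x, y) \<in> arcs_ends G \<Longrightarrow> f x \<noteq> f y"
    using assms(1) bipartite_iff_two_colourable[OF G(1)] unfolding two_colourable_def by blast
  have "u \<rightarrow>\<^bsub>G\<^esub> v \<longleftrightarrow> f u \<noteq> f v" if "u \<in> S" "v \<in> S" for u v
    by (rule complete_bipartite_colouring[where f = f, OF _ nonseparable_nonadj_trans[OF S] f that])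
      (use S in \<open>auto simp: nonseparable_def\<close>)
  from has_inner_tree_complete_bipartite[OF finite_subset[OF S(1) finite_verts] assms(2,3) this xy]
  show "has_inner_tree (k - 2) (k - 3) (\<lambda>u v. u \<rightarrow>\<^bsub>G\<^esub> v) S" .
qed (use assms in auto)

lemma even_exact_leaf_power:
  assumes "even k" "8 \<le> k"
  shows "exact_leaf_power k G"
proof (rule exact_leaf_power_if_blocks[where M = "k - 4"])
  fix S x y assume S: "S \<subseteq> verts G" "nonseparable (arcs_ends G) S" and xy: "x \<in> S" "y \<in> S" "x \<noteq> y"
  \<comment> \<open>The partite set of \<open>u\<close>, used as its name.\<close>
  define part where "part u = {v \<in> S. (u, v) \<notin> arcs_ends G}" for u
  have adj: "u \<rightarrow>\<^bsub>G\<^esub> v \<longleftrightarrow> part u \<noteq> part v" if "u \<in> S" "v \<in> S" for u v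
  proof
    assume "u \<rightarrow>\<^bsub>G\<^esub> v"
    then have "v \<notin> part u" "v \<in> part v" using that graph_irrefl[OF G(1)] by (auto simp: part_def)
    then show "part u \<noteq> part v" by blast
  next
    assume ne: "part u \<noteq> part v"
    show "u \<rightarrow>\<^bsub>G\<^esub> v"
    proof (rule ccontr)
      assume n: "\<not> u \<rightarrow>\<^bsub>G\<^esub> v"
      then have n': "\<not> v \<rightarrow>\<^bsub>G\<^esub> u" using graph_sym[OF G(1)] by (meson symD)
      have "part u = part v"
        using nonseparable_nonadj_trans[OF S that(2,1) _ n'] nonseparable_nonadj_trans[OF S that _ n]
        unfolding part_def by blast
      then show False using ne by blast
    qed
  qed
  have "connected_on (arcs_ends G) S" using S(2) unfolding nonseparable_def by blast
  from connected_on_neighbour[OF this xy] obtain z where z: "z \<in> S" "x \<rightarrow>\<^bsub>G\<^esub> z" .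
  have ne: "part x \<noteq> part z" using adj[OF xy(1) z(1)] z(2) by blast
  have "4 \<le> k" using assms(2) by simp
  from has_inner_tree_complete_multipartite[OF finite_subset[OF S(1) finite_verts] assms(1) this adj xy(1) z(1) ne]
  show "has_inner_tree (k - 2) (k - 4) (\<lambda>u v. u \<rightarrow>\<^bsub>G\<^esub> v) S" .
qed (use assms in auto)

end

end

theorem theorem6p3:
  fixes G :: "('a, 'b) pre_digraph"
  assumes "Digraph.graph G"
    and "Digraph_Component.connected G"
    and "\<forall>H. block H G \<longrightarrow> complete_multipartite H"
  shows "(\<forall>k\<ge>5. odd k \<longrightarrow>
            (exact_leaf_power k G \<longleftrightarrow> bipartite G) \<and>
            (bipartite G \<longleftrightarrow> (\<forall>H. block H G \<longrightarrow> complete_bipartite H))) \<and>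
         (\<forall>k\<ge>8. even k \<longrightarrow> exact_leaf_power k G)"
  using odd_exact_leaf_power_bipartite[OF assms(1)] odd_exact_leaf_power[OF assms]
    bipartite_iff_blocks_complete_bipartite[OF assms] even_exact_leaf_power[OF assms]
  by blast

end
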